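(* Let $A \subseteq \omega$ be infinite and suppose there is a single relative c.e. operator $\Theta$ such that $\Theta(S) = A$ for every infinite $S \subseteq A$. Then there is an infinite $B \subseteq A$ and a single Turing functional $\Phi$ such that $\Phi(S) = B$ for every infinite $S \subseteq B$.
   Context: A relative c.e. operator is a c.e. set $\Theta$ of pairs $(\sigma, x) \in 2^{<\omega}\times\omega$; for $X\subseteq\omega$, $\Theta(X)$ is the set of $x$ for which some initial segment $\sigma$ of the characteristic function of $X$ has $(\sigma,x)\in\Theta$. $\Phi(S)$ denotes the set computed by Turing functional $\Phi$ with oracle $S$. *)

theory Defs
  imports Main
begin

datatype prog =
    Zero
  | Succ
  | Proj nat
  | Comp prog "prog list"
  | Prim prog prog
  | Mu prog
  | Query

inductive reval :: "nat set \<Rightarrow> prog \<Rightarrow> nat list \<Rightarrow> nat \<Rightarrow> bool" for X where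
  zero: "reval X Zero xs 0"
| succ: "reval X Succ (x # xs) (Suc x)"
| proj: "i < length xs \<Longrightarrow> reval X (Proj i) xs (xs ! i)"
| comp: "list_all2 (\<lambda>g y. reval X g xs y) gs ys \<Longrightarrow> reval X f ys r \<Longrightarrow>
         reval X (Comp f gs) xs r"
| prim0: "reval X f xs r \<Longrightarrow> reval X (Prim f g) (0 # xs) r"
| primS: "reval X (Prim f g) (n # xs) r' \<Longrightarrow> reval X g (n # r' # xs) r \<Longrightarrow>
          reval X (Prim f g) (Suc n # xs) r"
| mu: "reval X f (n # xs) 0 \<Longrightarrow> (\<forall>m<n. \<exists>r. r \<noteq> 0 \<and> reval X f (m # xs) r) \<Longrightarrow>
       reval X (Mu f) xs n"
| query: "reval X Query (x # xs) (if x \<in> X then 1 else 0)"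
monos list.rel_mono

fun code_bits :: "bool list \<Rightarrow> nat" where
  "code_bits [] = 1"
| "code_bits (b # s) = 2 * code_bits s + (if b then 1 else 0)"

definition prefix_of :: "bool list \<Rightarrow> nat set \<Rightarrow> bool" where
  "prefix_of \<sigma> X \<longleftrightarrow> (\<forall>i < length \<sigma>. \<sigma> ! i = (i \<in> X))"

text \<open>A relative c.e. operator: a c.e. set of pairs (sigma, x), i.e. the domain
  of some (unrelativised) partial recursive function on the coded pairs.\<close>
definition rel_ce_operator :: "(bool list \<times> nat) set \<Rightarrow> bool" where
  "rel_ce_operator \<Theta> \<longleftrightarrow>
     (\<exists>p. \<Theta> = {(\<sigma>, x). \<exists>r. reval {} p [code_bits \<sigma>, x] r})"

definition apply_op :: "(bool list \<times> nat) set \<Rightarrow> nat set \<Rightarrow> nat set" where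
  "apply_op \<Theta> X = {x. \<exists>\<sigma>. prefix_of \<sigma> X \<and> (\<sigma>, x) \<in> \<Theta>}"

definition functional_computes :: "prog \<Rightarrow> nat set \<Rightarrow> nat set \<Rightarrow> bool" where
  "functional_computes \<Phi> S B \<longleftrightarrow>
     (\<forall>n. reval S \<Phi> [n] (if n \<in> B then 1 else 0))"

end

(*
  Fix time bounds on the enumeration and ask of a number y and a set X whether X enumerates y no
  later than a certain target that every X enumerates; this is a clopen property of the infinite
  subsets X of A. By Nash-Williams' theorem and diagonalisation there is an infinite H contained
  in A such that for each y and each finite F contained in A the answer for F together with S is
  the same value val y F for all infinite S in H lying beyond some bound, and the target can be
  chosen so that val y {} holds for each y in H. Let core be the set of y with val y {}, so that H
  is contained in core and core in A.

  A subset of H need not know H, so B is not chosen inside H. Instead call b good over n if adding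
  b changes none of the values val y F with y and F bounded by n. Almost all elements of H are good
  over n, and B takes as its next element the least number in core good over the previous one.
  Goodness is all that is needed for the answers on subsets of B to agree with val: if m is in B
  and S is an infinite subset of B beyond m, then S answers correctly all questions with parameters
  up to m. Hence an infinite S contained in B computes the successor in B of an element b, by
  bounded search below m, the next element of S above b.
*)
theory Submission
  imports Defs "HOL-Library.Nat_Bijection"
begin

section \<open>Functions computable uniformly in an oracle\<close>

text \<open>One program serves every oracle in \<open>\<C>\<close>, and totality is demanded only
  there: the unbounded searches used later are known to terminate only for suitable oracles.\<close>

definition computable_on :: "nat set set \<Rightarrow> nat \<Rightarrow> (nat set \<Rightarrow> nat list \<Rightarrow> nat) \<Rightarrow> bool" where
  "computable_on \<C> n f \<longleftrightarrow>
     (\<exists>p. \<forall>X\<in>\<C>. \<forall>xs. length xs = n \<longrightarrow> reval X p xs (f X xs))"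

abbreviation decidable_on :: "nat set set \<Rightarrow> nat \<Rightarrow> (nat set \<Rightarrow> nat list \<Rightarrow> bool) \<Rightarrow> bool" where
  "decidable_on \<C> n P \<equiv> computable_on \<C> n (\<lambda>X xs. of_bool (P X xs))"

text \<open>The length is fixed because \<open>Comp\<close> passes the whole vector on to a program
  of fixed arity.\<close>

definition computable_list_on ::
  "nat set set \<Rightarrow> nat \<Rightarrow> nat \<Rightarrow> (nat set \<Rightarrow> nat list \<Rightarrow> nat list) \<Rightarrow> bool" where
  "computable_list_on \<C> n m u \<longleftrightarrow>
     (\<forall>X\<in>\<C>. \<forall>xs. length xs = n \<longrightarrow> length (u X xs) = m) \<and>
     (\<forall>i<m. computable_on \<C> n (\<lambda>X xs. u X xs ! i))"

lemma computable_on_cong: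
  assumes "computable_on \<C> n f"
    and "\<And>X xs. X \<in> \<C> \<Longrightarrow> length xs = n \<Longrightarrow> f X xs = g X xs"
  shows "computable_on \<C> n g"
  using assms unfolding computable_on_def by metis

text \<open>\<open>Comp\<close> with one program per coordinate. In use this is a change of
  environment, argument lists playing the role of de Bruijn environments.\<close>

lemma computable_subst:
  assumes "computable_on \<C> m f" and "computable_list_on \<C> n m u"
  shows "computable_on \<C> n (\<lambda>X xs. f X (u X xs))"
proof -
  obtain pf where pf: "reval X pf ys (f X ys)" if "X \<in> \<C>" "length ys = m" for X ys
    using assms(1) unfolding computable_on_def by blast
  have "\<forall>i. \<exists>q. i < m \<longrightarrow> (\<forall>X\<in>\<C>. \<forall>xs. length xs = n \<longrightarrow> reval X q xs (u X xs ! i))"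
    using assms(2) unfolding computable_list_on_def computable_on_def by blast
  then obtain q where
    q: "reval X (q i) xs (u X xs ! i)" if "i < m" "X \<in> \<C>" "length xs = n" for i X xs
    by metis
  have "reval X (Comp pf (map q [0..<m])) xs (f X (u X xs))"
    if "X \<in> \<C>" "length xs = n" for X xs
  proof (rule reval.comp)
    have len: "length (u X xs) = m"
      using assms(2) that unfolding computable_list_on_def by blast
    then show "list_all2 (\<lambda>g y. reval X g xs y) (map q [0..<m]) (u X xs)"
      using q that by (simp add: list_all2_conv_all_nth)
    show "reval X pf (u X xs) (f X (u X xs))"
      using pf that len by blast
  qed
  then show ?thesis unfolding computable_on_def by blast
qed

lemma computable_nth: "i < n \<Longrightarrow> computable_on \<C> n (\<lambda>X xs. xs ! i)"
  unfolding computable_on_def by (rule exI[of _ "Proj i"]) (auto intro: reval.proj)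

lemma computable_list_id: "computable_list_on \<C> n n (\<lambda>X xs. xs)"
  unfolding computable_list_on_def by (auto intro: computable_nth)

lemma computable_list_Nil: "computable_list_on \<C> n 0 (\<lambda>X xs. [])"
  unfolding computable_list_on_def by simp

lemma computable_list_Cons:
  assumes "computable_on \<C> n f" "computable_list_on \<C> n m u"
  shows "computable_list_on \<C> n (Suc m) (\<lambda>X xs. f X xs # u X xs)"
  unfolding computable_list_on_def
proof (intro conjI ballI allI impI)
  fix i assume "i < Suc m"
  then show "computable_on \<C> n (\<lambda>X xs. (f X xs # u X xs) ! i)"
    using assms by (cases i) (auto simp: computable_list_on_def)
qed (use assms in \<open>simp add: computable_list_on_def\<close>)

lemma computable_list_tl:
  assumes "computable_list_on \<C> n (Suc m) u"
  shows "computable_list_on \<C> n m (\<lambda>X xs. tl (u X xs))"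
  unfolding computable_list_on_def
proof (intro conjI ballI allI impI)
  fix i assume "i < m"
  then have "computable_on \<C> n (\<lambda>X xs. u X xs ! Suc i)"
    using assms by (simp add: computable_list_on_def)
  then show "computable_on \<C> n (\<lambda>X xs. tl (u X xs) ! i)"
    by (rule computable_on_cong)
      (use assms \<open>i < m\<close> in \<open>simp add: computable_list_on_def nth_tl\<close>)
qed (use assms in \<open>simp add: computable_list_on_def\<close>)

lemma computable_hd:
  assumes "computable_list_on \<C> n (Suc m) u"
  shows "computable_on \<C> n (\<lambda>X xs. hd (u X xs))"
proof -
  have "computable_on \<C> n (\<lambda>X xs. u X xs ! 0)"
    using assms by (simp add: computable_list_on_def)
  then show ?thesis
    by (rule computable_on_cong)
      (use assms in \<open>auto simp: computable_list_on_def hd_conv_nth simp flip: length_greater_0_conv\<close>)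
qed

lemmas computable_env =
  computable_hd computable_list_tl computable_list_id computable_list_Nil computable_list_Cons

lemma computable_zero: "computable_on \<C> n (\<lambda>X xs. 0)"
  unfolding computable_on_def by (rule exI[of _ Zero]) (auto intro: reval.zero)

lemma computable_Suc:
  assumes "computable_on \<C> n f"
  shows "computable_on \<C> n (\<lambda>X xs. Suc (f X xs))"
proof -
  have "computable_on \<C> 1 (\<lambda>X xs. Suc (hd xs))"
    unfolding computable_on_def
    by (rule exI[of _ Succ]) (auto simp: length_Suc_conv intro: reval.succ)
  from computable_subst[OF this, of n "\<lambda>X xs. [f X xs]"] show ?thesis
    using computable_list_Cons[OF assms computable_list_Nil] by simp
qed

lemma decidable_oracle:
  assumes "computable_on \<C> n f"
  shows "decidable_on \<C> n (\<lambda>X xs. f X xs \<in> X)"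
proof -
  have *: "reval X Query [x] (of_bool (x \<in> X))" for X x
    using reval.query[of X x "[]"] by (simp add: of_bool_def cong: if_cong)
  have "computable_on \<C> 1 (\<lambda>X xs. of_bool (hd xs \<in> X))"
    unfolding computable_on_def
    by (rule exI[of _ Query]) (metis * One_nat_def length_0_conv length_Suc_conv list.sel(1))
  from computable_subst[OF this, of n "\<lambda>X xs. [f X xs]"] show ?thesis
    using computable_list_Cons[OF assms computable_list_Nil] by simp
qed

lemma computable_const: "computable_on \<C> n (\<lambda>X xs. c)"
  by (induction c) (auto intro: computable_zero computable_Suc)

text \<open>Counter and previous value stand in front of the environment, in the order in which
  \<open>Prim\<close> supplies them. Writing them with \<open>hd\<close> and \<open>tl\<close> lets
  unification take closed terms apart without naming any program.\<close>

lemma computable_rec_nat: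
  assumes t: "computable_on \<C> n t" and f: "computable_on \<C> n f"
    and g: "computable_on \<C> (Suc (Suc n)) (\<lambda>X ys. g X (hd ys) (hd (tl ys)) (tl (tl ys)))"
  shows "computable_on \<C> n (\<lambda>X xs. rec_nat (f X xs) (\<lambda>j r. g X j r xs) (t X xs))"
proof -
  obtain pf where pf: "reval X pf xs (f X xs)" if "X \<in> \<C>" "length xs = n" for X xs
    using f unfolding computable_on_def by blast
  obtain pg where pg: "reval X pg ys (g X (hd ys) (hd (tl ys)) (tl (tl ys)))"
    if "X \<in> \<C>" "length ys = Suc (Suc n)" for X ys
    using g unfolding computable_on_def by blast
  have "reval X (Prim pf pg) (k # xs) (rec_nat (f X xs) (\<lambda>j r. g X j r xs) k)"
    if "X \<in> \<C>" "length xs = n" for X xs k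
  proof (induction k)
    case 0
    then show ?case using pf that by (auto intro: reval.prim0)
  next
    case (Suc k)
    then show ?case
      using pg[of X "k # rec_nat (f X xs) (\<lambda>j r. g X j r xs) k # xs"] that
      by (auto intro: reval.primS)
  qed
  then have "computable_on \<C> (Suc n)
      (\<lambda>X ys. rec_nat (f X (tl ys)) (\<lambda>j r. g X j r (tl ys)) (hd ys))"
    unfolding computable_on_def
    by (intro exI[of _ "Prim pf pg"]) (auto simp: length_Suc_conv)
  from computable_subst[OF this computable_list_Cons[OF t computable_list_id]]
  show ?thesis by simp
qed

lemma computable_Least:
  assumes "decidable_on \<C> (Suc n) (\<lambda>X ys. P X (hd ys) (tl ys))"
    and "\<And>X xs. X \<in> \<C> \<Longrightarrow> length xs = n \<Longrightarrow> \<exists>k. P X k xs"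
  shows "computable_on \<C> n (\<lambda>X xs. LEAST k. P X k xs)"
proof -
  \<comment> \<open>Exchanges 0 and 1, because \<open>Mu\<close> searches for a zero.\<close>
  have one: "computable_on \<C> (Suc n) (\<lambda>X ys. rec_nat 1 (\<lambda>_ _. 0) (of_bool (P X (hd ys) (tl ys))))"
    by (rule computable_rec_nat) (rule assms computable_const)+
  obtain p where p: "reval X p ys (rec_nat 1 (\<lambda>_ _. 0) (of_bool (P X (hd ys) (tl ys))))"
    if "X \<in> \<C>" "length ys = Suc n" for X ys
    using one unfolding computable_on_def by blast
  have "reval X (Mu p) xs (LEAST k. P X k xs)" if "X \<in> \<C>" "length xs = n" for X xs
  proof (rule reval.mu)
    let ?k = "LEAST k. P X k xs"
    have "P X ?k xs" using assms(2) that by (metis LeastI)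
    then show "reval X p (?k # xs) 0"
      using p[of X "?k # xs"] that by simp
    show "\<forall>m<?k. \<exists>r. r \<noteq> 0 \<and> reval X p (m # xs) r"
    proof (intro allI impI)
      fix m assume "m < ?k"
      then have "\<not> P X m xs" by (rule not_less_Least)
      then show "\<exists>r. r \<noteq> 0 \<and> reval X p (m # xs) r"
        using p[of X "m # xs"] that by (intro exI[of _ 1]) simp
    qed
  qed
  then show ?thesis unfolding computable_on_def by blast
qed

text \<open>Weakening: moves a parameter under a quantifier or recursion, which puts one new
  variable in front.\<close>

lemma computable_tl:
  "computable_on \<C> n f \<Longrightarrow> computable_on \<C> (Suc n) (\<lambda>X ys. f X (tl ys))"
  by (erule computable_subst) (rule computable_list_tl[OF computable_list_id])

section \<open>Arithmetic, connectives and bounded quantifiers\<close>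

lemma computable_pred:
  assumes "computable_on \<C> n f" shows "computable_on \<C> n (\<lambda>X xs. f X xs - 1)"
proof -
  have "computable_on \<C> n (\<lambda>X xs. rec_nat 0 (\<lambda>j _. j) (f X xs))"
    by (rule computable_rec_nat assms computable_const computable_env)+
  then show ?thesis
    by (rule computable_on_cong) (auto split: nat.split simp: gr0_conv_Suc split: nat_diff_split)
qed

lemma computable_add:
  assumes "computable_on \<C> n f" "computable_on \<C> n g"
  shows "computable_on \<C> n (\<lambda>X xs. f X xs + g X xs)"
proof -
  have "computable_on \<C> n (\<lambda>X xs. rec_nat (f X xs) (\<lambda>_ r. Suc r) (g X xs))"
    by (rule computable_rec_nat assms computable_Suc computable_env)+
  moreover have "rec_nat a (\<lambda>_ r. Suc r) b = a + b" for a b :: nat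
    by (induction b) auto
  ultimately show ?thesis by simp
qed

lemma computable_diff:
  assumes "computable_on \<C> n f" "computable_on \<C> n g"
  shows "computable_on \<C> n (\<lambda>X xs. f X xs - g X xs)"
proof -
  have "computable_on \<C> n (\<lambda>X xs. rec_nat (f X xs) (\<lambda>_ r. r - 1) (g X xs))"
    by (rule computable_rec_nat assms computable_pred computable_env)+
  moreover have "rec_nat a (\<lambda>_ r. r - 1) b = a - b" for a b :: nat
    by (induction b) auto
  ultimately show ?thesis by simp
qed

lemma computable_mult:
  assumes "computable_on \<C> n f" "computable_on \<C> n g"
  shows "computable_on \<C> n (\<lambda>X xs. f X xs * g X xs)"
proof -
  have "computable_on \<C> n (\<lambda>X xs. rec_nat 0 (\<lambda>_ r. r + f X xs) (g X xs))"
    by (rule computable_rec_nat assms computable_const computable_add computable_env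
        assms(1)[THEN computable_tl, THEN computable_tl])+
  moreover have "rec_nat 0 (\<lambda>_ r. r + a) b = a * b" for a b :: nat
    by (induction b) auto
  ultimately show ?thesis by simp
qed

lemma computable_power:
  assumes "computable_on \<C> n f"
  shows "computable_on \<C> n (\<lambda>X xs. 2 ^ f X xs)"
proof -
  have "computable_on \<C> n (\<lambda>X xs. rec_nat 1 (\<lambda>_ r. 2 * r) (f X xs))"
    by (rule computable_rec_nat assms computable_const computable_mult computable_env)+
  moreover have "rec_nat 1 (\<lambda>_ r. 2 * r) b = (2::nat) ^ b" for b
    by (induction b) auto
  ultimately show ?thesis by simp
qed

lemma decidable_not:
  assumes "decidable_on \<C> n P"
  shows "decidable_on \<C> n (\<lambda>X xs. \<not> P X xs)"
proof -
  have "computable_on \<C> n (\<lambda>X xs. 1 - of_bool (P X xs))"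
    by (rule assms computable_const computable_diff)+
  then show ?thesis by (rule computable_on_cong) simp
qed

lemma decidable_conj:
  assumes "decidable_on \<C> n P" "decidable_on \<C> n Q"
  shows "decidable_on \<C> n (\<lambda>X xs. P X xs \<and> Q X xs)"
  unfolding of_bool_conj by (rule computable_mult assms)+

lemma decidable_disj:
  assumes "decidable_on \<C> n P" "decidable_on \<C> n Q"
  shows "decidable_on \<C> n (\<lambda>X xs. P X xs \<or> Q X xs)"
proof -
  have "decidable_on \<C> n (\<lambda>X xs. \<not> (\<not> P X xs \<and> \<not> Q X xs))"
    by (rule decidable_not decidable_conj assms)+
  then show ?thesis by simp
qed

lemma decidable_le:
  assumes "computable_on \<C> n f" "computable_on \<C> n g"
  shows "decidable_on \<C> n (\<lambda>X xs. f X xs \<le> g X xs)"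
proof -
  have "computable_on \<C> n (\<lambda>X xs. 1 - (f X xs - g X xs))"
    by (rule assms computable_const computable_diff)+
  then show ?thesis by (rule computable_on_cong) (simp add: of_bool_def)
qed

lemma decidable_less:
  assumes "computable_on \<C> n f" "computable_on \<C> n g"
  shows "decidable_on \<C> n (\<lambda>X xs. f X xs < g X xs)"
  unfolding Suc_le_eq[symmetric] by (rule decidable_le computable_Suc assms)+

lemma decidable_eq:
  assumes "computable_on \<C> n f" "computable_on \<C> n g"
  shows "decidable_on \<C> n (\<lambda>X xs. f X xs = g X xs)"
  unfolding order.eq_iff[of "_ :: nat"] by (rule decidable_conj decidable_le assms)+

lemma decidable_iff:
  assumes "decidable_on \<C> n P" "decidable_on \<C> n Q"
  shows "decidable_on \<C> n (\<lambda>X xs. P X xs \<longleftrightarrow> Q X xs)"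
  by (rule computable_on_cong[OF decidable_eq[OF assms]]) simp

lemma computable_if:
  assumes "decidable_on \<C> n P" "computable_on \<C> n f" "computable_on \<C> n g"
  shows "computable_on \<C> n (\<lambda>X xs. if P X xs then f X xs else g X xs)"
proof -
  have "computable_on \<C> n (\<lambda>X xs. of_bool (P X xs) * f X xs + of_bool (\<not> P X xs) * g X xs)"
    by (rule assms computable_add computable_mult decidable_not)+
  then show ?thesis by (rule computable_on_cong) simp
qed

lemma computable_sum:
  assumes t: "computable_on \<C> n t"
    and f: "computable_on \<C> (Suc n) (\<lambda>X ys. f X (hd ys) (tl ys))"
  shows "computable_on \<C> n (\<lambda>X xs. \<Sum>i<t X xs. f X i xs)"
proof -
  have *: "computable_on \<C> (Suc (Suc n)) (\<lambda>X ys. f X (hd ys) (tl (tl ys)))"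
    by (rule computable_subst[OF f, where u = "\<lambda>X ys. hd ys # tl (tl ys)", simplified])
      (rule computable_env)+
  have "computable_on \<C> n (\<lambda>X xs. rec_nat 0 (\<lambda>j r. r + f X j xs) (t X xs))"
    by (rule * computable_rec_nat t computable_const computable_add computable_env)+
  moreover have "rec_nat 0 (\<lambda>j r. r + h j) k = (\<Sum>i<k. h i)" for h :: "nat \<Rightarrow> nat" and k
    by (induction k) auto
  ultimately show ?thesis by simp
qed

lemma decidable_bex:
  assumes "computable_on \<C> n t"
    and "decidable_on \<C> (Suc n) (\<lambda>X ys. P X (hd ys) (tl ys))"
  shows "decidable_on \<C> n (\<lambda>X xs. \<exists>i<t X xs. P X i xs)"
proof -
  have "decidable_on \<C> n (\<lambda>X xs. \<not> (\<Sum>i<t X xs. of_bool (P X i xs)) \<le> (0::nat))"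
    by (rule decidable_not decidable_le computable_sum computable_const assms)+
  then show ?thesis by (rule computable_on_cong) auto
qed

lemma decidable_ball:
  assumes "computable_on \<C> n t"
    and "decidable_on \<C> (Suc n) (\<lambda>X ys. P X (hd ys) (tl ys))"
  shows "decidable_on \<C> n (\<lambda>X xs. \<forall>i<t X xs. P X i xs)"
proof -
  have "decidable_on \<C> n (\<lambda>X xs. \<not> (\<exists>i<t X xs. \<not> P X i xs))"
    by (rule decidable_not decidable_bex assms)+
  then show ?thesis by simp
qed

lemmas computable_intros =
  computable_Suc computable_add computable_diff computable_mult computable_power
  decidable_not decidable_conj decidable_disj decidable_le decidable_less decidable_eq
  decidable_iff decidable_bex decidable_ball computable_if computable_env computable_const

lemma decidable_set_decode:
  assumes "computable_on \<C> n i" "computable_on \<C> n c"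
  shows "decidable_on \<C> n (\<lambda>X xs. i X xs \<in> set_decode (c X xs))"
proof -
  \<comment> \<open>Division by \<open>2 ^ i\<close> becomes a search for quotient and remainder. An
    odd quotient \<open>2 * q + 1\<close> of \<open>c\<close> has \<open>q\<close> at most
    \<open>c\<close>, so bounded quantifiers suffice.\<close>
  have eq: "i \<in> set_decode c \<longleftrightarrow> (\<exists>q<Suc c. \<exists>r<2 ^ i. c = (2 * q + 1) * 2 ^ i + r)" for i c :: nat
  proof
    assume "i \<in> set_decode c"
    then have "odd (c div 2 ^ i)" by (simp add: set_decode_def)
    then obtain q where q: "c div 2 ^ i = 2 * q + 1" by (rule oddE)
    have c: "c = (2 * q + 1) * 2 ^ i + c mod 2 ^ i"
      by (metis q div_mult_mod_eq)
    moreover have "q < Suc c"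
      using q div_le_dividend[of c "2 ^ i"] by linarith
    ultimately show "\<exists>q<Suc c. \<exists>r<2 ^ i. c = (2 * q + 1) * 2 ^ i + r"
      by (intro exI[of _ q] conjI exI[of _ "c mod 2 ^ i"]) auto
  next
    assume "\<exists>q<Suc c. \<exists>r<2 ^ i. c = (2 * q + 1) * 2 ^ i + r"
    then obtain q r where "r < 2 ^ i" "c = (2 * q + 1) * 2 ^ i + r" by blast
    then have "c div 2 ^ i = 2 * q + 1"
      by (intro div_nat_eqI) (simp_all add: algebra_simps)
    then show "i \<in> set_decode c" by (simp add: set_decode_def)
  qed
  show ?thesis
    unfolding eq by (rule computable_intros assms assms[THEN computable_tl] assms[THEN computable_tl, THEN computable_tl])+
qed

section \<open>Bounded evaluation of programs\<close>

text \<open>\<open>bounded_eval t p xs\<close> is \<open>Suc r\<close> if \<open>p\<close> returns \<open>r\<close> with empty oracle and all its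
  unbounded searches succeed within \<open>t\<close> steps, and \<open>0\<close> otherwise.\<close>

fun bounded_eval :: "nat \<Rightarrow> prog \<Rightarrow> nat list \<Rightarrow> nat" where
  "bounded_eval t Zero xs = 1"
| "bounded_eval t Succ xs = (if xs = [] then 0 else Suc (Suc (hd xs)))"
| "bounded_eval t (Proj i) xs = (if i < length xs then Suc (xs ! i) else 0)"
| "bounded_eval t (Comp f gs) xs =
     (if \<forall>g\<in>set gs. 0 < bounded_eval t g xs
      then bounded_eval t f (map (\<lambda>g. bounded_eval t g xs - 1) gs) else 0)"
| "bounded_eval t (Prim f g) xs =
     (if xs = [] then 0 else
      rec_nat (bounded_eval t f (tl xs))
        (\<lambda>j r. if r = 0 then 0 else bounded_eval t g (j # (r - 1) # tl xs)) (hd xs))"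
| "bounded_eval t (Mu f) xs =
     (let n = (LEAST n. bounded_eval t f (n # xs) = 1 \<and>
                 (\<forall>m<n. 1 < bounded_eval t f (m # xs)) \<or> n = Suc t)
      in if n = Suc t then 0 else Suc n)"
| "bounded_eval t Query xs = (if xs = [] then 0 else 1)"

text \<open>\<open>Suc t\<close> is a sentinel that makes the \<open>LEAST\<close> in the
  \<open>Mu\<close> clause exist; here it is eliminated for the inductions that follow.\<close>

lemma bounded_eval_Mu_eq_Suc:
  "bounded_eval t (Mu f) xs = Suc n \<longleftrightarrow>
     n \<le> t \<and> bounded_eval t f (n # xs) = 1 \<and> (\<forall>m<n. 1 < bounded_eval t f (m # xs))"
  (is "_ \<longleftrightarrow> n \<le> t \<and> ?good n")
proof -
  define k where "k = (LEAST n. ?good n \<or> n = Suc t)"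
  have ev: "bounded_eval t (Mu f) xs = (if k = Suc t then 0 else Suc k)"
    by (simp add: k_def Let_def)
  have k: "?good k \<or> k = Suc t"
    unfolding k_def by (rule LeastI[of _ "Suc t"]) simp
  have le: "k \<le> Suc t"
    unfolding k_def by (rule Least_le) simp
  have eq: "k = n" if "n \<le> t" "?good n"
  proof -
    have "k \<le> n" unfolding k_def by (rule Least_le) (use that in simp)
    moreover have "?good k" using k that \<open>k \<le> n\<close> by auto
    ultimately show ?thesis using that
      by (metis less_irrefl le_neq_implies_less)
  qed
  show ?thesis
    unfolding ev
  proof
    assume "(if k = Suc t then 0 else Suc k) = Suc n"
    then have "k \<noteq> Suc t" "k = n" by (auto split: if_splits)
    then show "n \<le> t \<and> ?good n" using k le by auto
  next
    assume "n \<le> t \<and> ?good n"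
    then show "(if k = Suc t then 0 else Suc k) = Suc n" using eq by auto
  qed
qed

lemma bounded_eval_sound: "bounded_eval t p xs = Suc r \<Longrightarrow> reval {} p xs r"
proof (induction t p xs arbitrary: r rule: bounded_eval.induct)
  case (1 t xs)
  then show ?case by (auto intro: reval.zero)
next
  case (2 t xs)
  then show ?case by (cases xs) (auto intro: reval.succ)
next
  case (3 t i xs)
  then show ?case by (auto intro: reval.proj split: if_splits)
next
  case (4 t f gs xs)
  then have gs: "\<forall>g\<in>set gs. 0 < bounded_eval t g xs"
    and f: "bounded_eval t f (map (\<lambda>g. bounded_eval t g xs - 1) gs) = Suc r"
    by (auto split: if_splits)
  have *: "list_all2 (\<lambda>g y. reval {} g xs y) gs (map (\<lambda>g. bounded_eval t g xs - 1) gs)"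
    using gs 4(1) by (auto simp: list_all2_conv_all_nth)
  show ?case by (rule reval.comp[OF * 4(3)[OF gs f]])
next
  case (5 t f g xs)
  show ?case
  proof (cases xs)
    case Nil
    then show ?thesis using 5 by simp
  next
    case (Cons k ys)
    have "reval {} (Prim f g) (k # ys) r"
      if "rec_nat (bounded_eval t f ys)
        (\<lambda>j r. if r = 0 then 0 else bounded_eval t g (j # (r - 1) # ys)) k = Suc r" for k r
      using that
    proof (induction k arbitrary: r)
      case 0
      then show ?case using 5(1) Cons by (auto intro: reval.prim0)
    next
      case (Suc k)
      then obtain r' where r': "rec_nat (bounded_eval t f ys)
          (\<lambda>j r. if r = 0 then 0 else bounded_eval t g (j # (r - 1) # ys)) k = Suc r'"
        by (auto split: if_splits simp: gr0_conv_Suc)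
      with Suc have "bounded_eval t g (k # r' # ys) = Suc r" by simp
      then have "reval {} g (k # r' # ys) r"
        using 5(2)[of "Suc r'" k] Cons by simp
      then show ?case using Suc(1)[OF r'] by (auto intro: reval.primS)
    qed
    then show ?thesis using 5(3) Cons by (simp cong: if_cong)
  qed
next
  case (6 t f xs)
  then have "r \<le> t" and r: "bounded_eval t f (r # xs) = 1" "\<forall>m<r. 1 < bounded_eval t f (m # xs)"
    using bounded_eval_Mu_eq_Suc by blast+
  show ?case
  proof (rule reval.mu)
    show "reval {} f (r # xs) 0" using 6(1) r by simp
    show "\<forall>m<r. \<exists>s. s \<noteq> 0 \<and> reval {} f (m # xs) s"
    proof (intro allI impI)
      fix m assume "m < r"
      then obtain s where "bounded_eval t f (m # xs) = Suc s" "s \<noteq> 0"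
        using r(2) \<open>m < r\<close> by (cases "bounded_eval t f (m # xs)") auto
      then show "\<exists>s. s \<noteq> 0 \<and> reval {} f (m # xs) s" using 6(2) \<open>m < r\<close> by blast
    qed
  qed
next
  case (7 t xs)
  then show ?case
    by (cases xs) (use reval.query[of "{}"] in auto)
qed

text \<open>A larger bound only prolongs searches, and a search that has succeeded finds the same
  least zero again.\<close>

lemma bounded_eval_mono:
  "bounded_eval t p xs = Suc r \<Longrightarrow> t \<le> t' \<Longrightarrow> bounded_eval t' p xs = Suc r"
proof (induction t p xs arbitrary: r rule: bounded_eval.induct)
  case (4 t f gs xs)
  then have gs: "\<forall>g\<in>set gs. 0 < bounded_eval t g xs"
    and f: "bounded_eval t f (map (\<lambda>g. bounded_eval t g xs - 1) gs) = Suc r"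
    by (auto split: if_splits)
  have eq: "bounded_eval t' g xs = bounded_eval t g xs" if "g \<in> set gs" for g
    using 4(1)[OF that _ 4(5)] gs that by (metis gr0_conv_Suc)
  then have "map (\<lambda>g. bounded_eval t' g xs - 1) gs = map (\<lambda>g. bounded_eval t g xs - 1) gs"
    by simp
  then show ?case using 4(3)[OF gs f 4(5)] gs eq by (simp cong: map_cong)
next
  case (5 t f g xs)
  let ?h = "\<lambda>t. rec_nat (bounded_eval t f (tl xs))
        (\<lambda>j r. if r = 0 then 0 else bounded_eval t g (j # (r - 1) # tl xs))"
  have xs: "xs \<noteq> []" using 5 by auto
  have "?h t' k = Suc r" if "?h t k = Suc r" for k r
    using that
  proof (induction k arbitrary: r)
    case 0
    then show ?case using 5(1)[OF xs] 5(4) by simp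
  next
    case (Suc k)
    then obtain r' where r': "?h t k = Suc r'"
      by (auto split: if_splits simp: gr0_conv_Suc)
    with Suc have "bounded_eval t g (k # r' # tl xs) = Suc r" by simp
    then have "bounded_eval t' g (k # r' # tl xs) = Suc r"
      using 5(2)[of "Suc r'" k] xs 5(4) by simp
    then show ?case using Suc(1)[OF r'] by simp
  qed
  then show ?case using 5(3) xs by simp
next
  case (6 t f xs)
  then have r: "r \<le> t" "bounded_eval t f (r # xs) = 1" "\<forall>m<r. 1 < bounded_eval t f (m # xs)"
    using bounded_eval_Mu_eq_Suc by blast+
  have "bounded_eval t' f (r # xs) = 1"
    using 6(1)[of r 0] r 6(4) by simp
  moreover have "1 < bounded_eval t' f (m # xs)" if m: "m < r" for m
  proof -
    obtain s where s: "bounded_eval t f (m # xs) = Suc s" "s \<noteq> 0"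
      using r(3) m by (cases "bounded_eval t f (m # xs)") auto
    then have "bounded_eval t' f (m # xs) = Suc s" using 6(1)[of m s] 6(4) by simp
    then show ?thesis using s by simp
  qed
  ultimately show ?case using r(1) 6(4) bounded_eval_Mu_eq_Suc by auto
qed auto

lemma bounded_eval_complete: "reval {} p xs r \<Longrightarrow> \<exists>t. bounded_eval t p xs = Suc r"
proof (induction rule: reval.induct)
  case (comp xs gs ys f r)
  obtain tf where tf: "bounded_eval tf f ys = Suc r" using comp by blast
  \<comment> \<open>A common bound for all arguments, obtained by taking maxima along the
    list.\<close>
  have "\<exists>t. list_all2 (\<lambda>g y. bounded_eval t g xs = Suc y) gs ys"
    using comp(1)
  proof (induction rule: list_all2_induct)
    case (Cons g gs y ys)
    then obtain t1 t2 where "bounded_eval t1 g xs = Suc y"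
      "list_all2 (\<lambda>g y. bounded_eval t2 g xs = Suc y) gs ys" by blast
    then have "bounded_eval (max t1 t2) g xs = Suc y"
      "list_all2 (\<lambda>g y. bounded_eval (max t1 t2) g xs = Suc y) gs ys"
      by (auto elim!: list_all2_mono intro: bounded_eval_mono)
    then show ?case by blast
  qed simp
  then obtain tg where tg: "list_all2 (\<lambda>g y. bounded_eval tg g xs = Suc y) gs ys" by blast
  define t where "t = max tf tg"
  have f: "bounded_eval t f ys = Suc r"
    using tf by (rule bounded_eval_mono) (simp add: t_def)
  have gs: "list_all2 (\<lambda>g y. bounded_eval t g xs = Suc y) gs ys"
    using tg by (rule list_all2_mono) (auto simp: t_def intro: bounded_eval_mono)
  then have "map (\<lambda>g. bounded_eval t g xs - 1) gs = ys"
    by (auto simp: list_all2_conv_all_nth intro: nth_equalityI)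
  moreover have "\<forall>g\<in>set gs. 0 < bounded_eval t g xs"
    using gs by (auto simp: list_all2_conv_all_nth in_set_conv_nth)
  ultimately show ?case using f by auto
next
  case (primS f g n xs r' r)
  then obtain t1 t2 where "bounded_eval t1 (Prim f g) (n # xs) = Suc r'"
    "bounded_eval t2 g (n # r' # xs) = Suc r" by blast
  then have "bounded_eval (max t1 t2) (Prim f g) (n # xs) = Suc r'"
    "bounded_eval (max t1 t2) g (n # r' # xs) = Suc r"
    by (auto intro: bounded_eval_mono simp del: bounded_eval.simps)
  then have "bounded_eval (max t1 t2) (Prim f g) (Suc n # xs) = Suc r"
    by (simp cong: if_cong)
  then show ?case by blast
next
  case (mu f n xs)
  obtain t0 where t0: "bounded_eval t0 f (n # xs) = Suc 0" using mu by blast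
  have "\<forall>m. \<exists>t s. m < n \<longrightarrow> bounded_eval t f (m # xs) = Suc s \<and> s \<noteq> 0"
    using mu by blast
  then obtain T s where T: "bounded_eval (T m) f (m # xs) = Suc (s m)" "s m \<noteq> 0" if "m < n" for m
    by metis
  \<comment> \<open>The bound has to cover the finitely many subcomputations and also
    \<open>n\<close>, since the search runs only up to \<open>t\<close>.\<close>
  define t where "t = Max ({t0, n} \<union> T ` {..<n})"
  have "t0 \<le> t" "n \<le> t" and Tt: "\<And>m. m < n \<Longrightarrow> T m \<le> t"
    unfolding t_def by (rule Max_ge; simp)+
  then have "bounded_eval t f (n # xs) = 1" using bounded_eval_mono[OF t0] by simp
  moreover have "1 < bounded_eval t f (m # xs)" if "m < n" for m
    using bounded_eval_mono[OF T(1)[OF that] Tt[OF that]] T(2)[OF that] by simp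
  ultimately have "bounded_eval t (Mu f) xs = Suc n"
    using \<open>n \<le> t\<close> bounded_eval_Mu_eq_Suc by blast
  then show ?case by blast
qed auto

text \<open>The program \<open>p\<close> is fixed, so induction on its structure replaces a
  universal program. Arguments of the wrong arity give the constant 0.\<close>

lemma computable_bounded_eval_env:
  "computable_on \<C> (Suc n) (\<lambda>X xs. bounded_eval (hd xs) p (tl xs))"
proof (induction p arbitrary: n)
  case Zero
  show ?case by (simp add: computable_const)
next
  case Succ
  show ?case
  proof (cases n)
    case 0
    show ?thesis
      by (rule computable_on_cong[OF computable_const[of _ _ 0]]) (auto simp: 0 length_Suc_conv)
  next
    case (Suc m)
    have "computable_on \<C> (Suc n) (\<lambda>X xs. Suc (Suc (hd (tl xs))))"
      unfolding Suc by (rule computable_intros)+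
    then show ?thesis
      by (rule computable_on_cong) (auto simp: Suc length_Suc_conv)
  qed
next
  case (Proj i)
  show ?case
  proof (cases "i < n")
    case True
    then have "computable_on \<C> (Suc n) (\<lambda>X xs. Suc (xs ! Suc i))"
      by (intro computable_Suc computable_nth) simp
    then show ?thesis
      by (rule computable_on_cong) (use True in \<open>auto simp: length_Suc_conv\<close>)
  next
    case False
    show ?thesis
      by (rule computable_on_cong[OF computable_const[of _ _ 0]]) (use False in simp)
  qed
next
  case (Comp f gs)
  have "decidable_on \<C> (Suc n) (\<lambda>X xs. \<forall>g\<in>set gs. 0 < bounded_eval (hd xs) g (tl xs)) \<and>
    computable_list_on \<C> (Suc n) (length gs)
      (\<lambda>X xs. map (\<lambda>g. bounded_eval (hd xs) g (tl xs) - 1) gs)"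
    using Comp(2)
  proof (induction gs)
    case Nil
    show ?case by (simp add: computable_const computable_list_Nil)
  next
    case (Cons g gs)
    have g: "computable_on \<C> (Suc n) (\<lambda>X xs. bounded_eval (hd xs) g (tl xs))"
      using Cons.prems by simp
    have IH: "decidable_on \<C> (Suc n) (\<lambda>X xs. \<forall>g\<in>set gs. 0 < bounded_eval (hd xs) g (tl xs))"
      "computable_list_on \<C> (Suc n) (length gs)
        (\<lambda>X xs. map (\<lambda>g. bounded_eval (hd xs) g (tl xs) - 1) gs)"
      using Cons by auto
    show ?case
      unfolding list.set ball_simps list.map list.size add_Suc_right add_0_right
      by (intro conjI; (rule g IH computable_intros)+)
  qed
  note gs = conjunct1[OF this] conjunct2[OF this]
  have f: "computable_on \<C> (Suc n)
     (\<lambda>X xs. bounded_eval (hd xs) f (map (\<lambda>g. bounded_eval (hd xs) g (tl xs) - 1) gs))"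
    by (rule computable_subst[OF Comp(1),
          where u = "\<lambda>X xs. hd xs # map (\<lambda>g. bounded_eval (hd xs) g (tl xs) - 1) gs",
          unfolded list.sel]) (rule gs computable_intros)+
  show ?case
    unfolding bounded_eval.simps by (rule computable_if f gs(1) computable_const)+
next
  case (Prim f g)
  show ?case
  proof (cases n)
    case 0
    show ?thesis
      by (rule computable_on_cong[OF computable_const[of _ _ 0]]) (auto simp: 0 length_Suc_conv)
  next
    case (Suc m)
    have f: "computable_on \<C> (Suc n) (\<lambda>X xs. bounded_eval (hd xs) f (tl (tl xs)))"
      by (rule computable_subst[OF Prim(1), where u = "\<lambda>X xs. hd xs # tl (tl xs)", unfolded list.sel])
        (unfold Suc, (rule computable_env)+)
    have g: "computable_on \<C> (Suc (Suc (Suc n)))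
       (\<lambda>X ys. bounded_eval (hd (tl (tl ys))) g (hd ys # (hd (tl ys) - 1) # tl (tl (tl (tl ys)))))"
      by (rule computable_subst[OF Prim(2), unfolded list.sel,
          where u = "\<lambda>X ys. hd (tl (tl ys)) # hd ys # (hd (tl ys) - 1) # tl (tl (tl (tl ys)))",
          unfolded list.sel])
        (unfold Suc, (rule computable_intros)+)
    have "computable_on \<C> (Suc n) (\<lambda>X xs. rec_nat (bounded_eval (hd xs) f (tl (tl xs)))
      (\<lambda>j r. if r = 0 then 0 else bounded_eval (hd xs) g (j # (r - 1) # tl (tl xs))) (hd (tl xs)))"
      unfolding Suc
      by (rule computable_rec_nat f[unfolded Suc] g[unfolded Suc] computable_if decidable_eq
          computable_const computable_env)+
    then show ?thesis
      by (rule computable_on_cong) (auto simp: Suc length_Suc_conv)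
  qed
next
  case (Mu f)
  have f: "computable_on \<C> (Suc (Suc n)) (\<lambda>X ys. bounded_eval (hd (tl ys)) f (hd ys # tl (tl ys)))"
    by (rule computable_subst[OF Mu, where u = "\<lambda>X ys. hd (tl ys) # hd ys # tl (tl ys)", unfolded list.sel])
      (rule computable_env)+
  have f': "computable_on \<C> (Suc (Suc (Suc n)))
      (\<lambda>X ys. bounded_eval (hd (tl (tl ys))) f (hd ys # tl (tl (tl ys))))"
    by (rule computable_subst[OF Mu, where u = "\<lambda>X ys. hd (tl (tl ys)) # hd ys # tl (tl (tl ys))", unfolded list.sel])
      (rule computable_env)+
  \<comment> \<open>The sentinel disjunct makes this search total; \<open>exI\<close>,
    \<open>disjI2\<close> and \<open>refl\<close> supply it as the witness.\<close>
  have L: "computable_on \<C> (Suc n) (\<lambda>X xs. LEAST n. bounded_eval (hd xs) f (n # tl xs) = 1 \<and>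
      (\<forall>m<n. 1 < bounded_eval (hd xs) f (m # tl xs)) \<or> n = Suc (hd xs))"
    by (rule computable_Least exI disjI2 refl f f' computable_intros)+
  show ?case
    unfolding bounded_eval.simps Let_def by (rule L computable_intros)+
next
  case Query
  show ?case
  proof (cases n)
    case 0
    show ?thesis
      by (rule computable_on_cong[OF computable_const[of _ _ 0]]) (auto simp: 0 length_Suc_conv)
  next
    case (Suc m)
    show ?thesis
      by (rule computable_on_cong[OF computable_const[of _ _ 1]]) (auto simp: Suc length_Suc_conv)
  qed
qed

lemma computable_bounded_eval:
  assumes "computable_on \<C> n t" "computable_list_on \<C> n m u"
  shows "computable_on \<C> n (\<lambda>X xs. bounded_eval (t X xs) p (u X xs))"
  using computable_subst[OF computable_bounded_eval_env computable_list_Cons[OF assms]]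
  by simp

section \<open>Homogeneous sets for clopen colorings\<close>

lemma ex_tail:
  fixes S :: "nat set"
  assumes "infinite S" shows "infinite (S \<inter> {n<..})"
proof
  assume "finite (S \<inter> {n<..})"
  then have "finite ({..n} \<union> (S \<inter> {n<..}))" by simp
  moreover have "S \<subseteq> {..n} \<union> (S \<inter> {n<..})" by auto
  ultimately show False using assms finite_subset by blast
qed

lemma Inf_in:
  fixes X :: "nat set"
  assumes "infinite X" shows "Inf X \<in> X"
  using assms by (metis Inf_nat_def1 infinite_imp_nonempty)

text \<open>Shrink a reservoir repeatedly: \<open>R (Suc i)\<close> lies beyond the minimum of
  \<open>R i\<close> and satisfies \<open>P\<close> at that minimum. In the set of these minima,
  everything above the one of stage \<open>i\<close> lies in \<open>R (Suc i)\<close>.\<close>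

lemma fusion:
  fixes P :: "nat \<Rightarrow> nat set \<Rightarrow> bool"
  assumes H0: "infinite H0" "H0 \<subseteq> A"
    and hereditary: "\<And>h H H'. P h H \<Longrightarrow> H' \<subseteq> H \<Longrightarrow> P h H'"
    and dense: "\<And>h H. h \<in> A \<Longrightarrow> infinite H \<Longrightarrow> H \<subseteq> A \<Longrightarrow> \<exists>H'\<subseteq>H. infinite H' \<and> P h H'"
  shows "\<exists>H\<subseteq>H0. infinite H \<and> (\<forall>h\<in>H. P h (H \<inter> {h<..}))"
proof -
  define next_res where "next_res R =
    (SOME R'. R' \<subseteq> R \<inter> {Inf R<..} \<and> infinite R' \<and> P (Inf R) R')" for R :: "nat set"
  have next_res: "next_res R \<subseteq> R \<inter> {Inf R<..} \<and> infinite (next_res R) \<and> P (Inf R) (next_res R)"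
    if "infinite R" "R \<subseteq> A" for R
  proof -
    have "Inf R \<in> A" using that Inf_nat_def1 by (metis infinite_imp_nonempty subsetD)
    then have "\<exists>R'\<subseteq>R \<inter> {Inf R<..}. infinite R' \<and> P (Inf R) R'"
      using dense ex_tail[OF that(1)] that(2) by (meson inf.coboundedI1)
    then show ?thesis unfolding next_res_def by (metis (mono_tags, lifting) someI_ex)
  qed
  define R where "R i = (next_res ^^ i) H0" for i
  have R: "infinite (R i) \<and> R i \<subseteq> H0" for i
  proof (induction i)
    case (Suc i)
    then show ?case using next_res[of "R i"] H0 by (auto simp: R_def)
  qed (use H0 in \<open>simp add: R_def\<close>)
  have step: "R (Suc i) \<subseteq> R i \<inter> {Inf (R i)<..} \<and> P (Inf (R i)) (R (Suc i))" for i
    using next_res[of "R i"] R[of i] H0 by (auto simp: R_def)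
  define h where "h i = Inf (R i)" for i
  have hR: "h i \<in> R i" for i
    unfolding h_def using R[of i] by (metis Inf_nat_def1 infinite_imp_nonempty)
  have R_anti: "R j \<subseteq> R i" if "i \<le> j" for i j
    using step that by (intro lift_Suc_antimono_le[of R i j]) blast
  have mono: "strict_mono h"
    unfolding strict_mono_Suc_iff using hR step unfolding h_def by blast
  have "P (h i) (range h \<inter> {h i<..})" for i
  proof (rule hereditary)
    show "P (h i) (R (Suc i))" using step by (simp add: h_def)
    show "range h \<inter> {h i<..} \<subseteq> R (Suc i)"
    proof clarify
      fix j assume "h i < h j"
      then have "Suc i \<le> j" using mono by (simp add: strict_mono_less Suc_le_eq)
      then show "h j \<in> R (Suc i)" using hR R_anti by blast
    qed
  qed
  moreover have "infinite (range h)"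
    using mono by (simp add: finite_image_iff strict_mono_imp_inj_on)
  moreover have "range h \<subseteq> H0" using hR R by blast
  ultimately show ?thesis by blast
qed

text \<open>This says that \<open>C\<close> is clopen on the infinite subsets of \<open>A\<close>,
  in the topology inherited from Cantor space.\<close>

definition locally_constant_on :: "nat set \<Rightarrow> (nat set \<Rightarrow> bool) \<Rightarrow> bool" where
  "locally_constant_on A C \<longleftrightarrow>
     (\<forall>X\<subseteq>A. infinite X \<longrightarrow>
       (\<exists>k. \<forall>Y\<subseteq>A. infinite Y \<longrightarrow> Y \<inter> {..<k} = X \<inter> {..<k} \<longrightarrow> C Y = C X))"

definition homogeneous :: "nat set \<Rightarrow> (nat set \<Rightarrow> bool) \<Rightarrow> bool" where
  "homogeneous H C \<longleftrightarrow> (\<exists>c. \<forall>S\<subseteq>H. infinite S \<longrightarrow> C S = c)"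

lemma homogeneous_subset: "homogeneous H C \<Longrightarrow> H' \<subseteq> H \<Longrightarrow> homogeneous H' C"
  unfolding homogeneous_def by (meson order_trans)

lemma locally_constant_Un:
  assumes "locally_constant_on A C" "F \<subseteq> A"
  shows "locally_constant_on A (\<lambda>S. C (F \<union> S))"
  unfolding locally_constant_on_def
proof (intro allI impI)
  fix X assume X: "X \<subseteq> A" "infinite X"
  then obtain k where k: "C Y = C (F \<union> X)"
    if "Y \<subseteq> A" "infinite Y" "Y \<inter> {..<k} = (F \<union> X) \<inter> {..<k}" for Y
    using assms unfolding locally_constant_on_def by (metis Un_least finite_Un)
  show "\<exists>k. \<forall>Y\<subseteq>A. infinite Y \<longrightarrow> Y \<inter> {..<k} = X \<inter> {..<k} \<longrightarrow> C (F \<union> Y) = C (F \<union> X)"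
    by (intro exI[of _ k] allI impI k) (use assms(2) in \<open>auto simp: Int_Un_distrib2\<close>)
qed

text \<open>Either \<open>F\<close> has homogeneous sets everywhere or some one-point extension of \<open>F\<close> fails to;
  iterating the second alternative yields an infinite set at which \<open>C\<close> is not locally constant.\<close>

lemma nash_williams:
  assumes C: "locally_constant_on A C" and H0: "infinite H0" "H0 \<subseteq> A"
  shows "\<exists>H\<subseteq>H0. infinite H \<and> homogeneous H C"
proof (rule ccontr)
  assume contra: "\<not> ?thesis"
  define good where "good F \<longleftrightarrow>
    (\<forall>H0\<subseteq>A. infinite H0 \<longrightarrow> (\<exists>H\<subseteq>H0. infinite H \<and> homogeneous H (\<lambda>S. C (F \<union> S))))" for F
  have step: "\<exists>s\<in>A. (\<forall>f\<in>F. f < s) \<and> \<not> good (insert s F)" if "\<not> good F" "finite F" for F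
  proof (rule ccontr)
    assume "\<not> ?thesis"
    then have ext: "good (insert s F)" if "s \<in> A" "\<forall>f\<in>F. f < s" for s using that by blast
    have "\<exists>H\<subseteq>H0. infinite H \<and> homogeneous H (\<lambda>S. C (F \<union> S))"
      if H0': "H0 \<subseteq> A" "infinite H0" for H0
    proof -
      \<comment> \<open>Inserting 0 keeps \<open>Max\<close> meaningful when \<open>F\<close> is
        empty.\<close>
      define G where "G = H0 - {..Max (insert 0 F)}"
      have G: "infinite G" "G \<subseteq> A" "G \<subseteq> H0" using H0' by (auto simp: G_def)
      have Gs: "\<forall>f\<in>F. f < s" if "s \<in> G" for s
        using that \<open>finite F\<close> by (auto simp: G_def Max_less_iff not_le)
      obtain H where H: "H \<subseteq> G" "infinite H"
        and "\<forall>h\<in>H. homogeneous (H \<inter> {h<..}) (\<lambda>S. C (insert h F \<union> S))"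
      proof -
        have "\<exists>H\<subseteq>G. infinite H \<and>
            (\<forall>h\<in>H. homogeneous (H \<inter> {h<..}) (\<lambda>S. C (insert h F \<union> S)))"
        proof (rule fusion[OF G(1) order_refl])
          fix h H assume "h \<in> G" "infinite H" "H \<subseteq> G"
          then have "good (insert h F)" "H \<subseteq> A" using ext Gs G by auto
          then show "\<exists>H'\<subseteq>H. infinite H' \<and> homogeneous H' (\<lambda>S. C (insert h F \<union> S))"
            using \<open>infinite H\<close> unfolding good_def by blast
        qed (rule homogeneous_subset)
        then show thesis using that by blast
      qed
      then have "\<forall>h\<in>H. \<exists>c. \<forall>S\<subseteq>H \<inter> {h<..}. infinite S \<longrightarrow> C (insert h F \<union> S) = c"
        unfolding homogeneous_def by simp
      then obtain c where c: "C (insert h F \<union> S) = c h"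
        if "h \<in> H" "S \<subseteq> H \<inter> {h<..}" "infinite S" for h S
        by (auto dest!: bchoice)
      have "H = {h\<in>H. c h} \<union> {h\<in>H. \<not> c h}" by blast
      then have "infinite {h\<in>H. c h} \<or> infinite {h\<in>H. \<not> c h}"
        using H(2) by (metis finite_Un)
      then obtain b where b: "infinite {h\<in>H. c h = b}"
        by (cases "infinite {h\<in>H. c h}") (auto intro: that[of True] that[of False])
      \<comment> \<open>\<open>S\<close> is its least element \<open>s\<close> together with a set
        beyond \<open>s\<close>, so its colour is \<open>c s\<close>, and \<open>c\<close> is
        constant on the set chosen here.\<close>
      have "C (F \<union> S) = b" if S: "S \<subseteq> {h\<in>H. c h = b}" "infinite S" for S
      proof -
        define s where "s = Inf S"
        have s: "s \<in> S" unfolding s_def using S(2) by (metis Inf_nat_def1 infinite_imp_nonempty)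
        have "s \<le> x" if "x \<in> S" for x unfolding s_def using that by (simp add: cInf_lower)
        then have "S - {s} \<subseteq> H \<inter> {s<..}" using S(1) by (force simp: le_less)
        then have "C (insert s F \<union> (S - {s})) = c s"
          using S s by (intro c) auto
        moreover have "insert s F \<union> (S - {s}) = F \<union> S" using s by blast
        ultimately show ?thesis using S s by auto
      qed
      then have "homogeneous {h\<in>H. c h = b} (\<lambda>S. C (F \<union> S))"
        unfolding homogeneous_def by blast
      then show ?thesis using b H(1) G(3) by (intro exI[of _ "{h\<in>H. c h = b}"]) auto
    qed
    then have "good F" unfolding good_def by blast
    then show False using that by blast
  qed
  define nx where "nx F = (SOME s. s \<in> A \<and> (\<forall>f\<in>F. f < s) \<and> \<not> good (insert s F))" for F
  have nx: "nx F \<in> A \<and> (\<forall>f\<in>F. f < nx F) \<and> \<not> good (insert (nx F) F)"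
    if "\<not> good F" "finite F" for F
  proof -
    have "\<exists>s. s \<in> A \<and> (\<forall>f\<in>F. f < s) \<and> \<not> good (insert s F)"
      using step[OF that] by blast
    from someI_ex[OF this] show ?thesis unfolding nx_def .
  qed
  \<comment> \<open>Starting from the empty set, each bad set is extended by a larger element and
    stays bad.\<close>
  define F where "F i = ((\<lambda>F. insert (nx F) F) ^^ i) {}" for i
  have F_Suc: "F (Suc i) = insert (nx (F i)) (F i)" for i by (simp add: F_def)
  have F: "\<not> good (F i) \<and> finite (F i) \<and> F i \<subseteq> A" for i
  proof (induction i)
    case 0
    have "\<not> good {}"
      using contra H0 unfolding good_def by auto
    then show ?case by (simp add: F_def)
  next
    case (Suc i)
    then show ?case using nx[of "F i"] by (simp add: F_Suc)
  qed
  define s where "s i = nx (F i)" for i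
  have s: "s i \<in> A" "f \<in> F i \<Longrightarrow> f < s i" for i f
    using nx[of "F i"] F[of i] by (auto simp: s_def)
  have mono: "strict_mono s"
    unfolding strict_mono_Suc_iff by (intro allI s(2)) (simp add: F_Suc s_def)
  have F_eq: "F i = s ` {..<i}" for i
    by (induction i) (auto simp: F_Suc s_def lessThan_Suc, simp add: F_def)
  define X where "X = range s"
  have "infinite X"
    unfolding X_def using mono by (simp add: finite_image_iff strict_mono_imp_inj_on)
  moreover have "X \<subseteq> A" using s by (auto simp: X_def)
  ultimately obtain k where k: "C Y = C X"
    if "Y \<subseteq> A" "infinite Y" "Y \<inter> {..<k} = X \<inter> {..<k}" for Y
    using C unfolding locally_constant_on_def by blast
  \<comment> \<open>Since \<open>s i\<close> is at least \<open>i\<close>, \<open>F k\<close>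
    contains all elements of \<open>X\<close> below \<open>k\<close>. Adding only elements from
    \<open>k\<close> on leaves that initial segment unchanged, so the colour is that of
    \<open>X\<close>.\<close>
  have "good (F k)"
    unfolding good_def
  proof (intro allI impI)
    fix H assume H: "H \<subseteq> A" "infinite H"
    have "C (F k \<union> S) = C X" if S: "S \<subseteq> H - {..<k}" "infinite S" for S
    proof (rule k)
      have "s i < k \<Longrightarrow> i < k" for i
        using strict_mono_imp_increasing[OF mono, of i] by simp
      then show "(F k \<union> S) \<inter> {..<k} = X \<inter> {..<k}"
        using S by (auto simp: F_eq X_def)
    qed (use F S H in auto)
    then have "homogeneous (H - {..<k}) (\<lambda>S. C (F k \<union> S))"
      unfolding homogeneous_def by blast
    then show "\<exists>G\<subseteq>H. infinite G \<and> homogeneous G (\<lambda>S. C (F k \<union> S))"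
      using H by (intro exI[of _ "H - {..<k}"]) auto
  qed
  then show False using F by blast
qed

text \<open>Fusion, where each \<open>h\<close> has to deal with finitely many colorings only; these
  are made homogeneous one after the other.\<close>

lemma simultaneous_nash_williams:
  assumes H0: "infinite H0" "H0 \<subseteq> A"
    and fin: "\<And>h. finite (I h)"
    and C: "\<And>h i. i \<in> I h \<Longrightarrow> locally_constant_on A (C i)"
  shows "\<exists>H\<subseteq>H0. infinite H \<and> (\<forall>h\<in>H. \<forall>i\<in>I h. homogeneous (H \<inter> {h<..}) (C i))"
proof (rule fusion[OF H0])
  fix h H H'
  assume "\<forall>i\<in>I h. homogeneous H (C i)" "H' \<subseteq> H"
  then show "\<forall>i\<in>I h. homogeneous H' (C i)" using homogeneous_subset by blast
next
  fix h and H :: "nat set" assume H: "infinite H" "H \<subseteq> A"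
  have "\<exists>H'\<subseteq>H. infinite H' \<and> (\<forall>i\<in>J. homogeneous H' (C i))" if "finite J" "J \<subseteq> I h" for J
    using that
  proof (induction J)
    case empty
    then show ?case using H by blast
  next
    case (insert i J)
    then obtain H1 where H1: "H1 \<subseteq> H" "infinite H1" "\<forall>i\<in>J. homogeneous H1 (C i)" by auto
    then obtain H2 where "H2 \<subseteq> H1" "infinite H2" "homogeneous H2 (C i)"
      using nash_williams[OF C, of i h H1] insert.prems H by blast
    then show ?case using H1 homogeneous_subset by (intro exI[of _ H2]) auto
  qed
  then show "\<exists>H'\<subseteq>H. infinite H' \<and> (\<forall>i\<in>I h. homogeneous H' (C i))" using fin by blast
qed

section \<open>Questions with homogeneous answers\<close>

locale introenumerable =
  fixes A :: "nat set" and en :: "nat set \<Rightarrow> nat \<Rightarrow> nat \<Rightarrow> bool"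
  assumes infinite_A: "infinite A"
    and en_cong: "X \<inter> {..<k} = Y \<inter> {..<k} \<Longrightarrow> en X k x = en Y k x"
    and en_mono: "en X k x \<Longrightarrow> k \<le> k' \<Longrightarrow> en X k' x"
    and en_iff: "S \<subseteq> A \<Longrightarrow> infinite S \<Longrightarrow> (\<exists>k. en S k x) \<longleftrightarrow> x \<in> A"
begin

text \<open>Ties count as yes, so of two enumerated elements at least one comes no later than the
  other. The \<open>LEAST\<close> is meaningful when \<open>X\<close> enumerates \<open>x\<close> at
  all.\<close>

definition no_later :: "nat \<Rightarrow> nat \<Rightarrow> nat set \<Rightarrow> bool" where
  "no_later y x X \<longleftrightarrow> en X (LEAST k. en X k x) y"

text \<open>Let \<open>k\<close> be the first stage at which \<open>x\<close> appears. All stages up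
  to \<open>k\<close> depend on the oracle below \<open>k\<close> only, so that initial segment
  fixes both \<open>k\<close> and the answer.\<close>

lemma no_later_cong:
  assumes "en X k0 x"
  shows "\<exists>k. \<forall>Y. Y \<inter> {..<k} = X \<inter> {..<k} \<longrightarrow> no_later y x Y = no_later y x X"
proof -
  define k where "k = (LEAST k. en X k x)"
  have k: "en X k x" unfolding k_def by (rule LeastI[of _ k0]) (rule assms)
  have "no_later y x Y = no_later y x X" if Y: "Y \<inter> {..<k} = X \<inter> {..<k}" for Y
  proof -
    have eq: "en Y j z = en X j z" if "j \<le> k" for j z
    proof (rule en_cong)
      have "Y \<inter> {..<j} = (Y \<inter> {..<k}) \<inter> {..<j}" using that by auto
      also have "\<dots> = X \<inter> {..<j}" unfolding Y using that by auto
      finally show "Y \<inter> {..<j} = X \<inter> {..<j}" .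
    qed
    have "(LEAST k. en Y k x) = k"
    proof (rule Least_equality)
      show "en Y k x" using k eq by simp
      show "k \<le> j" if "en Y j x" for j
      proof (rule ccontr)
        assume "\<not> k \<le> j"
        then have "en X j x" using eq that by simp
        then show False using \<open>\<not> k \<le> j\<close> unfolding k_def by (simp add: Least_le)
      qed
    qed
    then show ?thesis unfolding no_later_def k_def[symmetric] using eq by simp
  qed
  then show ?thesis by blast
qed

lemma locally_constant_no_later:
  assumes "x \<in> A" shows "locally_constant_on A (no_later y x)"
  unfolding locally_constant_on_def
  using no_later_cong assms en_iff by meson

text \<open>A target depending on the least element covers both a constant target and the least
  element itself. That element is removed from the oracle because homogeneity at \<open>h\<close>
  concerns sets beyond \<open>h\<close>.\<close>

definition before_target :: "(nat \<Rightarrow> nat) \<Rightarrow> nat \<Rightarrow> nat set \<Rightarrow> bool" where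
  "before_target tgt y X \<longleftrightarrow> no_later y (tgt (Inf X)) (X - {Inf X})"

text \<open>A yes gives a stage at which an infinite subset of \<open>A\<close> enumerates
  \<open>y\<close>.\<close>

lemma before_target_in:
  assumes "before_target tgt y X" "X \<subseteq> A" "infinite X"
  shows "y \<in> A"
  using assms en_iff[of "X - {Inf X}" y] unfolding before_target_def no_later_def by auto

lemma locally_constant_before_target:
  assumes "\<And>m. m \<in> A \<Longrightarrow> tgt m \<in> A"
  shows "locally_constant_on A (before_target tgt y)"
  unfolding locally_constant_on_def
proof (intro allI impI)
  fix X assume X: "X \<subseteq> A" "infinite X"
  define m where "m = Inf X"
  have m: "m \<in> X" using Inf_in X by (simp add: m_def)
  then have "tgt m \<in> A" using assms X by blast
  moreover have "X - {m} \<subseteq> A" "infinite (X - {m})" using X by auto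
  ultimately obtain k0 where "en (X - {m}) k0 (tgt m)" using en_iff by blast
  from no_later_cong[OF this] obtain k where
    k: "no_later y (tgt m) Y = no_later y (tgt m) (X - {m})"
    if "Y \<inter> {..<k} = (X - {m}) \<inter> {..<k}" for Y by blast
  have "before_target tgt y Y = before_target tgt y X"
    \<comment> \<open>The segment must reach past \<open>m\<close>, so that \<open>Y\<close> has the
      same least element and hence the same target.\<close>
    if Y: "Y \<inter> {..<max k (Suc m)} = X \<inter> {..<max k (Suc m)}" for Y
  proof -
    have iff: "i \<in> Y \<longleftrightarrow> i \<in> X" if "i < max k (Suc m)" for i
      using Y that by blast
    have "Inf Y = m"
    proof (rule cInf_eq_minimum)
      show "m \<in> Y" using iff m by simp
      show "m \<le> i" if "i \<in> Y" for i
      proof (rule ccontr)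
        assume "\<not> m \<le> i"
        then have "i \<in> X" using iff that by simp
        then show False using \<open>\<not> m \<le> i\<close> by (simp add: m_def cInf_lower)
      qed
    qed
    then show ?thesis unfolding before_target_def m_def[symmetric]
      by simp (rule k, use iff in auto)
  qed
  then show "\<exists>k. \<forall>Y\<subseteq>A. infinite Y \<longrightarrow> Y \<inter> {..<k} = X \<inter> {..<k} \<longrightarrow>
      before_target tgt y Y = before_target tgt y X" by blast
qed

text \<open>Order the elements of \<open>A\<close> by the time at which almost all subsets of a homogeneous \<open>H\<close>
  enumerate them. If some \<open>a\<close> has infinitely many predecessors in \<open>H\<close> then \<open>a\<close> serves as target;
  otherwise \<open>H\<close> has order type \<open>\<omega>\<close>, and the least element of the oracle serves as target.\<close>

lemma exists_target:
  obtains tgt H where "tgt = id \<or> (\<exists>a. tgt = (\<lambda>_. a))" "\<And>m. m \<in> A \<Longrightarrow> tgt m \<in> A"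
    "H \<subseteq> A" "infinite H"
    "\<And>y. y \<in> H \<Longrightarrow> \<exists>n. \<forall>S\<subseteq>H \<inter> {n<..}. infinite S \<longrightarrow> before_target tgt y S"
proof -
  \<comment> \<open>Each \<open>h\<close> handles only the pairs bounded by \<open>h\<close>, yet
    every pair is covered from some \<open>h\<close> on. The target \<open>x\<close> is taken from
    \<open>A\<close>, where the question is locally constant.\<close>
  have "\<exists>H\<subseteq>A. infinite H \<and> (\<forall>h\<in>H. \<forall>i\<in>({..h} \<inter> A) \<times> {..h}.
      homogeneous (H \<inter> {h<..}) ((\<lambda>(x, y). no_later y x) i))"
    by (rule simultaneous_nash_williams[OF infinite_A order_refl])
      (auto simp: locally_constant_no_later)
  then obtain H where H: "H \<subseteq> A" "infinite H"
    and hom: "\<And>h x y. h \<in> H \<Longrightarrow> x \<in> A \<Longrightarrow> x \<le> h \<Longrightarrow> y \<le> h \<Longrightarrow>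
      homogeneous (H \<inter> {h<..}) (no_later y x)" by auto
  \<comment> \<open>The limiting verdict along \<open>H\<close>; \<open>W\<close> shows that for
    parameters up to \<open>h\<close> it is already reached beyond \<open>h\<close>.\<close>
  define w where "w x y \<longleftrightarrow> (\<exists>n. \<forall>S\<subseteq>H \<inter> {n<..}. infinite S \<longrightarrow> no_later y x S)" for x y
  have W: "no_later y x S \<longleftrightarrow> w x y"
    if h: "h \<in> H" "x \<in> A" "x \<le> h" "y \<le> h" and S: "S \<subseteq> H \<inter> {h<..}" "infinite S" for h x y S
  proof -
    obtain c where c: "no_later y x S = c" if "S \<subseteq> H \<inter> {h<..}" "infinite S" for S
      using hom[OF h] unfolding homogeneous_def by blast
    have "w x y = c"
    proof
      assume "w x y"
      then obtain n where n: "no_later y x S" if "S \<subseteq> H \<inter> {n<..}" "infinite S" for S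
        unfolding w_def by blast
      have inf: "infinite (H \<inter> {max n h<..})" using H(2) by (rule ex_tail)
      have "H \<inter> {max n h<..} \<subseteq> H \<inter> {n<..}" "H \<inter> {max n h<..} \<subseteq> H \<inter> {h<..}" by auto
      then show c using n[OF _ inf] c[OF _ inf] by simp
    next
      assume c
      then show "w x y" unfolding w_def using c by blast
    qed
    then show ?thesis using c S by blast
  qed
  show thesis
  proof (cases "\<exists>a\<in>H. infinite {y\<in>H. w a y}")
    case True
    then obtain a where a: "a \<in> H" "infinite {y\<in>H. w a y}" by blast
    show thesis
    proof (rule that[of "\<lambda>_. a" "{y\<in>H. w a y}"])
      fix y assume "y \<in> {y\<in>H. w a y}"
      then obtain n where n: "no_later y a S" if "S \<subseteq> H \<inter> {n<..}" "infinite S" for S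
        unfolding w_def by blast
      show "\<exists>n. \<forall>S\<subseteq>{y \<in> H. w a y} \<inter> {n<..}. infinite S \<longrightarrow> before_target (\<lambda>_. a) y S"
        unfolding before_target_def
        by (intro exI[of _ n] allI impI n) auto
    qed (use a H in auto)
  next
    case False
    show thesis
    proof (rule that[of id H])
      fix y assume y: "y \<in> H"
      then have "finite {s\<in>H. w y s}" using False by blast
      then obtain n where n: "\<And>s. s \<in> H \<Longrightarrow> w y s \<Longrightarrow> s \<le> n"
        using finite_nat_set_iff_bounded_le by auto
      have "before_target id y S" if S: "S \<subseteq> H \<inter> {max n y<..}" "infinite S" for S
      proof -
        define s T where "s = Inf S" and "T = S - {s}"
        have s: "s \<in> S" using Inf_in S by (simp add: s_def)
        have sH: "s \<in> H" "s \<in> A" "y < s" "n < s" using s S H by auto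
        have "s \<le> x" if "x \<in> S" for x using that by (simp add: s_def cInf_lower)
        then have T: "T \<subseteq> H \<inter> {s<..}" "infinite T" using S by (force simp: T_def le_less)+
        have TA: "T \<subseteq> A" using T H by auto
        \<comment> \<open>Here \<open>s\<close> is both the bound \<open>h\<close> in
          \<open>W\<close> and the element compared with \<open>y\<close>. As \<open>s\<close> is
          not enumerated by the time \<open>y\<close> is, \<open>y\<close> comes no later than
          \<open>s\<close>.\<close>
        have "\<not> w y s" using n[OF sH(1)] sH(4) by auto
        then have "\<not> no_later s y T" using W[OF sH(1) _ _ _ T] y sH H by auto
        then have lt: "\<not> en T (LEAST k. en T k y) s" by (simp add: no_later_def)
        have y_in: "en T (LEAST k. en T k y) y"
          using en_iff[OF TA T(2)] y H by (metis LeastI subsetD)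
        have s_in: "en T (LEAST k. en T k s) s"
          using en_iff[OF TA T(2)] sH by (metis LeastI)
        have "(LEAST k. en T k y) \<le> (LEAST k. en T k s)"
          using lt s_in en_mono nat_le_linear by blast
        then have "no_later y s T" unfolding no_later_def using y_in en_mono by blast
        then show ?thesis by (simp add: before_target_def s_def T_def)
      qed
      then show "\<exists>n. \<forall>S\<subseteq>H \<inter> {n<..}. infinite S \<longrightarrow> before_target id y S" by blast
    qed (use H in auto)
  qed
qed

end

section \<open>Limit answers and the construction of the subset \<open>range bs\<close>\<close>

locale homogeneous_queries =
  fixes A H :: "nat set" and Q :: "nat \<Rightarrow> nat set \<Rightarrow> bool"
  assumes H: "infinite H" "H \<subseteq> A"
    and Q_in: "Q y X \<Longrightarrow> X \<subseteq> A \<Longrightarrow> infinite X \<Longrightarrow> y \<in> A"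
    and Q_locally_constant: "locally_constant_on A (Q y)"
    and Q_H: "y \<in> H \<Longrightarrow> \<exists>n. \<forall>S\<subseteq>H \<inter> {n<..}. infinite S \<longrightarrow> Q y S"
    and Q_homogeneous: "finite F \<Longrightarrow> F \<subseteq> A \<Longrightarrow> \<exists>n. homogeneous (H \<inter> {n<..}) (\<lambda>S. Q y (F \<union> S))"
begin

definition val :: "nat \<Rightarrow> nat set \<Rightarrow> bool" where
  "val y F \<longleftrightarrow> (\<exists>n. \<forall>S\<subseteq>H \<inter> {n<..}. infinite S \<longrightarrow> Q y (F \<union> S))"

text \<open>By homogeneity the answer is constant on some tail of \<open>H\<close>, and two tails of
  \<open>H\<close> share an infinite set. Hence failure of \<open>val\<close> means an eventual no
  and not mere oscillation.\<close>

lemma eventually_val: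
  assumes "finite F" "F \<subseteq> A"
  shows "\<exists>n. \<forall>S\<subseteq>H \<inter> {n<..}. infinite S \<longrightarrow> Q y (F \<union> S) = val y F"
proof -
  obtain n where "homogeneous (H \<inter> {n<..}) (\<lambda>S. Q y (F \<union> S))"
    using Q_homogeneous[OF assms] ..
  then obtain c where "\<forall>S\<subseteq>H \<inter> {n<..}. infinite S \<longrightarrow> Q y (F \<union> S) = c"
    unfolding homogeneous_def ..
  then have n: "Q y (F \<union> S) = c" if "S \<subseteq> H \<inter> {n<..}" "infinite S" for S
    using that by simp
  have "val y F = c"
  proof
    assume "val y F"
    then obtain m where m: "Q y (F \<union> S)" if "S \<subseteq> H \<inter> {m<..}" "infinite S" for S
      unfolding val_def by blast
    have inf: "infinite (H \<inter> {max m n<..})" using H(1) by (rule ex_tail)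
    have "H \<inter> {max m n<..} \<subseteq> H \<inter> {m<..}" "H \<inter> {max m n<..} \<subseteq> H \<inter> {n<..}" by auto
    then show c using m[OF _ inf] n[OF _ inf] by simp
  next
    assume c
    then show "val y F" unfolding val_def using n by blast
  qed
  then show ?thesis using n by blast
qed

text \<open>For large \<open>b\<close>, adding \<open>b\<close> and a far tail of \<open>H\<close>
  to \<open>F\<close> can be read as adding a tail to \<open>insert b F\<close> or a subset of a
  tail to \<open>F\<close>.\<close>

lemma val_insert:
  assumes F: "finite F" "F \<subseteq> A"
  shows "\<exists>n. \<forall>b\<in>H. n < b \<longrightarrow> val y (insert b F) = val y F"
proof -
  obtain n where n: "Q y (F \<union> S) = val y F" if "S \<subseteq> H \<inter> {n<..}" "infinite S" for S
    using eventually_val[OF F] by blast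
  have "val y (insert b F) = val y F" if b: "b \<in> H" "n < b" for b
  proof -
    have "insert b F \<subseteq> A" using b H F by auto
    then obtain k where k: "Q y (insert b F \<union> S) = val y (insert b F)"
      if "S \<subseteq> H \<inter> {k<..}" "infinite S" for S
      using eventually_val[of "insert b F"] F by blast
    let ?S = "H \<inter> {max k n<..}"
    have inf: "infinite ?S" using H(1) by (rule ex_tail)
    have "val y (insert b F) = Q y (insert b F \<union> ?S)"
      by (rule k[symmetric]) (use inf in auto)
    also have "insert b F \<union> ?S = F \<union> insert b ?S" by auto
    also have "Q y (F \<union> insert b ?S) = val y F" using inf b by (intro n) auto
    finally show ?thesis .
  qed
  then show ?thesis by blast
qed

definition core :: "nat set" where "core = {y. val y {}}"

lemma core_subset: "core \<subseteq> A"
proof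
  fix y assume "y \<in> core"
  then obtain n where "Q y ({} \<union> (H \<inter> {n<..}))"
    unfolding core_def val_def using ex_tail[OF H(1)] by blast
  then show "y \<in> A" using Q_in[of y "H \<inter> {n<..}"] ex_tail[OF H(1)] H(2) by auto
qed

lemma H_subset_core: "H \<subseteq> core"
  unfolding core_def val_def using Q_H by auto

text \<open>\<open>F\<close> ranges over subsets of \<open>core\<close> and not of the set under
  construction, so the next element depends on the last one alone.\<close>

definition good :: "nat \<Rightarrow> nat \<Rightarrow> bool" where
  "good n b \<longleftrightarrow> n < b \<and> b \<in> core \<and>
     (\<forall>y\<le>n. \<forall>F\<subseteq>core \<inter> {..n}. val y (insert b F) = val y F)"

text \<open>Only finitely many pairs of \<open>y\<close> and \<open>F\<close> matter, and
  \<open>val_insert\<close> gives a threshold in \<open>H\<close> for each.\<close>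

lemma ex_good: "\<exists>b. good n b"
proof -
  have "\<forall>p\<in>{..n} \<times> Pow (core \<inter> {..n}). \<exists>k. \<forall>b\<in>H. k < b \<longrightarrow>
      val (fst p) (insert b (snd p)) = val (fst p) (snd p)"
    using val_insert core_subset finite_subset[OF _ finite_atMost[of n]] by auto
  from bchoice[OF this] obtain k where
    "\<forall>p\<in>{..n} \<times> Pow (core \<inter> {..n}). \<forall>b\<in>H. k p < b \<longrightarrow>
      val (fst p) (insert b (snd p)) = val (fst p) (snd p)" ..
  then have k: "val y (insert b F) = val y F"
    if "y \<le> n" "F \<subseteq> core \<inter> {..n}" "b \<in> H" "k (y, F) < b" for y F b
    using that by fastforce
  have fin: "finite (k ` ({..n} \<times> Pow (core \<inter> {..n})))" by simp
  define K where "K = Max (insert n (k ` ({..n} \<times> Pow (core \<inter> {..n}))))"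
  have K: "n \<le> K" "\<And>y F. y \<le> n \<Longrightarrow> F \<subseteq> core \<inter> {..n} \<Longrightarrow> k (y, F) \<le> K"
    unfolding K_def using fin by (auto intro!: Max_ge)
  obtain b where "b \<in> H" "K < b"
    using infinite_imp_nonempty[OF ex_tail[OF H(1), of K]] by auto
  then have "good n b" unfolding good_def using K k H_subset_core
    by (meson le_less_trans subsetD)
  then show ?thesis by blast
qed

lemma good_mono: "good n b \<Longrightarrow> m \<le> n \<Longrightarrow> good m b"
  unfolding good_def by (meson Int_mono atMost_subset_iff le_less_trans order_refl order_trans)

primrec bs :: "nat \<Rightarrow> nat" where
  "bs 0 = (LEAST b. b \<in> core)"
| "bs (Suc i) = (LEAST b. good (bs i) b)"

lemma good_bs_Suc: "good (bs i) (bs (Suc i))"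
  using ex_good by (simp add: LeastI_ex)

lemma strict_mono_bs: "strict_mono bs"
  unfolding strict_mono_Suc_iff using good_bs_Suc good_def by blast

lemma good_bs:
  assumes "bs i < bs j" shows "good (bs i) (bs j)"
proof -
  have "i < j" using assms strict_mono_bs by (simp add: strict_mono_less)
  then obtain j' where j': "j = Suc j'" "i \<le> j'" by (cases j) auto
  then show ?thesis
    using good_mono[OF good_bs_Suc, of "bs i" j'] strict_mono_bs by (simp add: strict_mono_less_eq)
qed

lemma infinite_bs: "infinite (range bs)"
  using strict_mono_bs by (simp add: finite_image_iff strict_mono_imp_inj_on)

lemma bs_core: "range bs \<subseteq> core"
proof clarify
  fix i show "bs i \<in> core"
  proof (cases i)
    case 0
    have "\<exists>b. b \<in> core"
      using H(1) H_subset_core by (metis Inf_nat_def1 infinite_imp_nonempty subsetD)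
    then show ?thesis using 0 LeastI_ex[of "\<lambda>b. b \<in> core"] by simp
  qed (use good_bs_Suc good_def in simp)
qed

text \<open>The elements of \<open>G\<close> are added in increasing order. Each is good over its
  predecessor \<open>q'\<close> in \<open>insert q G\<close>, and \<open>q'\<close> bounds
  \<open>y\<close> and everything added before.\<close>

lemma val_Un:
  assumes q: "q \<in> range bs" and y: "y \<le> q" and F: "F \<subseteq> core \<inter> {..q}"
    and G: "finite G" "G \<subseteq> range bs \<inter> {q<..}"
  shows "val y (F \<union> G) = val y F"
  using G
proof (induction G rule: finite_linorder_max_induct)
  case (insert b G)
  define q' where "q' = Max (insert q G)"
  have "q' \<in> insert q G" unfolding q'_def using insert.hyps by (intro Max_in) auto
  then have "q' \<in> range bs" "q' < b" using q insert by auto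
  then have "good q' b" using good_bs insert.prems by auto
  moreover have le: "x \<le> q'" if "x \<in> insert q G" for x
    unfolding q'_def using that insert.hyps by (intro Max_ge) auto
  moreover have "F \<union> G \<subseteq> core \<inter> {..q'}"
    using F insert.prems bs_core le by force
  moreover have "y \<le> q'" using y le by (meson insertI1 order_trans)
  ultimately have "val y (insert b (F \<union> G)) = val y (F \<union> G)"
    unfolding good_def by blast
  then show ?case using insert by simp
qed simp

text \<open>\<open>S\<close> need not meet \<open>H\<close>. Local constancy allows the part of
  \<open>S\<close> from some \<open>k\<close> on to be replaced by a tail of \<open>H\<close>, which
  gives \<open>val\<close> of the remaining finite part; \<open>val_Un\<close> then removes the
  elements of \<open>S\<close> from it.\<close>

lemma Q_eq_val:
  assumes q: "q \<in> range bs" and y: "y \<le> q" and F: "F \<subseteq> core \<inter> {..q}"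
    and S: "S \<subseteq> range bs \<inter> {q<..}" "infinite S"
  shows "Q y (F \<union> S) = val y F"
proof -
  have "S \<subseteq> A" "F \<subseteq> A" using F S bs_core core_subset by blast+
  then have FS: "F \<union> S \<subseteq> A" "infinite (F \<union> S)" using S by auto
  then obtain k where k: "Q y Y = Q y (F \<union> S)"
    if "Y \<subseteq> A" "infinite Y" "Y \<inter> {..<k} = (F \<union> S) \<inter> {..<k}" for Y
    using Q_locally_constant unfolding locally_constant_on_def by blast
  define G where "G = F \<union> (S \<inter> {..<k})"
  have G: "finite G" "G \<subseteq> A" using F FS finite_subset[of F "{..q}"] by (auto simp: G_def)
  then obtain n where n: "Q y (G \<union> T) = val y G" if "T \<subseteq> H \<inter> {n<..}" "infinite T" for T
    using eventually_val by blast
  let ?T = "H \<inter> {max n k<..}"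
  have T: "infinite ?T" using H(1) by (rule ex_tail)
  have "Q y (F \<union> S) = Q y (G \<union> ?T)"
    by (rule k[symmetric]) (use T G H in \<open>auto simp: G_def\<close>)
  also have "\<dots> = val y G" using T by (intro n) auto
  also have "\<dots> = val y F" unfolding G_def using q y F S by (intro val_Un) auto
  finally show ?thesis .
qed

end

text \<open>A second thinning stabilises the questions with a finite part \<open>F\<close>. The
  positive answers from \<open>exists_target\<close> survive it, as they concern all infinite
  subsets of a tail.\<close>

lemma (in introenumerable) exists_homogeneous_queries:
  obtains tgt H where "tgt = id \<or> (\<exists>a. tgt = (\<lambda>_. a))" "\<And>m. m \<in> A \<Longrightarrow> tgt m \<in> A"
    "homogeneous_queries A H (before_target tgt)"
proof -
  obtain tgt H0 where tgt: "tgt = id \<or> (\<exists>a. tgt = (\<lambda>_. a))" "\<And>m. m \<in> A \<Longrightarrow> tgt m \<in> A"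
    and H0: "H0 \<subseteq> A" "infinite H0"
    and Q_H0: "\<And>y. y \<in> H0 \<Longrightarrow> \<exists>n. \<forall>S\<subseteq>H0 \<inter> {n<..}. infinite S \<longrightarrow> before_target tgt y S"
    by (rule exists_target) (rule that)
  let ?C = "\<lambda>p S. before_target tgt (fst p) (snd p \<union> S)"
  have "\<exists>H\<subseteq>H0. infinite H \<and>
      (\<forall>h\<in>H. \<forall>p\<in>{..h} \<times> Pow ({..h} \<inter> A). homogeneous (H \<inter> {h<..}) (?C p))"
    by (rule simultaneous_nash_williams[OF H0(2,1)])
      (auto intro!: locally_constant_Un locally_constant_before_target tgt)
  then obtain H where H: "H \<subseteq> H0" "infinite H"
    and hom: "\<And>h p. h \<in> H \<Longrightarrow> p \<in> {..h} \<times> Pow ({..h} \<inter> A) \<Longrightarrow> homogeneous (H \<inter> {h<..}) (?C p)"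
    by blast
  have "homogeneous_queries A H (before_target tgt)"
  proof
    show "H \<subseteq> A" using H(1) H0(1) by (rule order_trans)
    show "locally_constant_on A (before_target tgt y)" for y
      using tgt(2) by (rule locally_constant_before_target)
    show "\<exists>n. \<forall>S\<subseteq>H \<inter> {n<..}. infinite S \<longrightarrow> before_target tgt y S" if y: "y \<in> H" for y
    proof -
      obtain n where "\<forall>S\<subseteq>H0 \<inter> {n<..}. infinite S \<longrightarrow> before_target tgt y S"
        using Q_H0[of y] y H(1) by blast
      moreover have "H \<inter> {n<..} \<subseteq> H0 \<inter> {n<..}" using H(1) by blast
      ultimately show ?thesis by (meson order_trans)
    qed
    show "\<exists>n. homogeneous (H \<inter> {n<..}) (\<lambda>S. before_target tgt y (F \<union> S))"
      if F: "finite F" "F \<subseteq> A" for F y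
    proof -
      \<comment> \<open>Beyond \<open>y\<close> and all of \<open>F\<close>, so that the pair is
        among those handled at \<open>h\<close>.\<close>
      obtain h where h: "h \<in> H" "Max (insert y F) < h"
        using infinite_imp_nonempty[OF ex_tail[OF H(2), of "Max (insert y F)"]] by auto
      have "i \<le> h" if "i \<in> insert y F" for i
        using that F h(2) by (auto intro: less_imp_le)
      then have "(y, F) \<in> {..h} \<times> Pow ({..h} \<inter> A)" using F by auto
      from hom[OF h(1) this] show ?thesis by auto
    qed
  qed (use H before_target_in in auto)
  with tgt show thesis by (rule that)
qed

section \<open>Computing the subset\<close>

text \<open>Turns the quantifier over finite sets in \<open>good\<close> into a bounded numerical
  one: the largest code of a subset of \<open>{..n}\<close> is \<open>2 ^ Suc n - 1\<close>.\<close>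

lemma set_decode_subset_iff: "set_decode c \<subseteq> {..n} \<longleftrightarrow> c < 2 ^ Suc n"
proof
  assume "set_decode c \<subseteq> {..n}"
  then have "set_encode (set_decode c) \<le> set_encode {..n}"
    by (simp add: set_encode_def sum_mono2)
  also have "\<dots> < 2 ^ Suc n"
    unfolding set_encode_def lessThan_Suc_atMost[symmetric]
    by (induction n) auto
  finally show "c < 2 ^ Suc n" by simp
next
  assume c: "c < 2 ^ Suc n"
  have "i \<le> n" if "i \<in> set_decode c" for i
  proof (rule ccontr)
    assume "\<not> i \<le> n"
    then have "(2::nat) ^ Suc n \<le> 2 ^ i" by (intro power_increasing) auto
    then have "c div 2 ^ i = 0" using c by simp
    then show False using that by (simp add: set_decode_def)
  qed
  then show "set_decode c \<subseteq> {..n}" by blast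
qed

text \<open>Questions are put to sets computed from the oracle, such as a tail with a finite part
  added, so \<open>X\<close> is any set decided uniformly from \<open>S\<close>. Its being an
  infinite subset of \<open>A\<close> is what will make the underlying search stop.\<close>

locale computable_queries = homogeneous_queries +
  assumes decidable_Q: "\<And>\<C> n X y.
    decidable_on \<C> (Suc n) (\<lambda>S ys. hd ys \<in> X S (tl ys)) \<Longrightarrow>
    (\<And>S xs. S \<in> \<C> \<Longrightarrow> length xs = n \<Longrightarrow> X S xs \<subseteq> A \<and> infinite (X S xs)) \<Longrightarrow>
    computable_on \<C> n y \<Longrightarrow> decidable_on \<C> n (\<lambda>S xs. Q (y S xs) (X S xs))"
begin

definition oracles :: "nat set set" where
  "oracles = {S. S \<subseteq> range bs \<and> infinite S}"

lemma oracles_tail: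
  assumes "S \<in> oracles"
  shows "S \<inter> {m<..} \<subseteq> A" "infinite (S \<inter> {m<..})"
  using assms bs_core core_subset ex_tail unfolding oracles_def by blast+

definition next_elem :: "nat set \<Rightarrow> nat \<Rightarrow> nat" where
  "next_elem S b = (LEAST s. s \<in> S \<and> b < s)"

lemma next_elem:
  assumes "S \<in> oracles" shows "next_elem S b \<in> S" "b < next_elem S b"
proof -
  have "\<exists>s. s \<in> S \<and> b < s"
    using infinite_imp_nonempty[OF oracles_tail(2)[OF assms, of b]] by auto
  from LeastI_ex[OF this] show "next_elem S b \<in> S" "b < next_elem S b"
    by (simp_all add: next_elem_def)
qed

text \<open>Membership in \<open>core\<close> is replaced by an answer of the tail beyond
  \<open>m\<close>; the two agree up to \<open>m\<close> when \<open>m\<close> is in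
  \<open>range bs\<close> and \<open>S\<close> in \<open>oracles\<close>.\<close>

definition coded_part :: "nat set \<Rightarrow> nat \<Rightarrow> nat \<Rightarrow> nat set" where
  "coded_part S m c = {i. i \<in> set_decode c \<and> i \<le> m \<and> Q i (S \<inter> {m<..})}"

text \<open>True for every \<open>m\<close>, even if the answers differ from \<open>core\<close>,
  because a yes always certifies membership in \<open>A\<close>. This keeps \<open>query\<close>
  decidable for all arguments.\<close>

lemma coded_part_subset: "S \<in> oracles \<Longrightarrow> coded_part S m c \<subseteq> A"
  using Q_in oracles_tail by (auto simp: coded_part_def)

definition query :: "nat set \<Rightarrow> nat \<Rightarrow> nat \<Rightarrow> nat \<Rightarrow> bool" where
  "query S m c y \<longleftrightarrow> Q y (coded_part S m c \<union> (S \<inter> {m<..}))"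

text \<open>The test for \<open>good b b'\<close> quantifies over \<open>c\<close> instead of the finite sets it codes; the
  disjunct \<open>b' = m\<close> only serves to make the search terminate for every \<open>b\<close>.\<close>

definition step :: "nat set \<Rightarrow> nat \<Rightarrow> nat" where
  "step S b = (let m = next_elem S b in
     LEAST b'. b < b' \<and> Q b' (S \<inter> {m<..}) \<and>
       (\<forall>y<Suc b. \<forall>c<2 ^ Suc b. query S m (c + 2 ^ b') y \<longleftrightarrow> query S m c y) \<or> b' = m)"

text \<open>The next oracle element \<open>m\<close> lies in \<open>range bs\<close> and is
  therefore good over \<open>bs i\<close>, so the least good number is at most \<open>m\<close>. Up
  to \<open>m\<close> the answers of the tail are the true values of \<open>val\<close>.\<close>

lemma step_bs:
  assumes S: "S \<in> oracles"
  shows "step S (bs i) = bs (Suc i)"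
proof -
  define b m T where "b = bs i" and "m = next_elem S b" and "T = S \<inter> {m<..}"
  have "m \<in> S" "b < m" unfolding m_def using next_elem S by auto
  then have m: "m \<in> range bs" using S by (auto simp: oracles_def)
  then have good_m: "good b m" using good_bs \<open>b < m\<close> by (auto simp: b_def)
  have T: "T \<subseteq> range bs \<inter> {m<..}" "infinite T"
    using S ex_tail by (auto simp: oracles_def T_def)
  have Q_val: "Q y (F \<union> T) = val y F" if "y \<le> m" "F \<subseteq> core \<inter> {..m}" for y F
    using Q_eq_val[OF m that T] .
  have Q_core: "Q y T \<longleftrightarrow> y \<in> core" if "y \<le> m" for y
    using Q_val[OF that, of "{}"] by (simp add: core_def)
  have part: "coded_part S m c = core \<inter> set_decode c \<inter> {..m}" for c
    using Q_core by (auto simp: coded_part_def T_def[symmetric])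
  have query_val: "query S m c y = val y (core \<inter> set_decode c \<inter> {..m})" if "y \<le> m" for c y
    unfolding query_def part T_def[symmetric] using that by (rule Q_val) auto
  \<comment> \<open>A code of a set not contained in \<open>core\<close> merely repeats the
    condition for its intersection with \<open>core\<close>.\<close>
  have test: "(\<forall>y<Suc b. \<forall>c<2 ^ Suc b. query S m (c + 2 ^ b') y \<longleftrightarrow> query S m c y) \<longleftrightarrow>
      (\<forall>y\<le>b. \<forall>F\<subseteq>core \<inter> {..b}. val y (insert b' F) = val y F)"
    if b': "b < b'" "b' \<le> m" "b' \<in> core" for b'
  proof -
    have eq: "query S m c y = val y (core \<inter> set_decode c)"
      "query S m (c + 2 ^ b') y = val y (insert b' (core \<inter> set_decode c))"
      if "y \<le> b" "set_decode c \<subseteq> {..b}" for c y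
    proof -
      have "core \<inter> set_decode c \<inter> {..m} = core \<inter> set_decode c"
        using that \<open>b < m\<close> by auto
      then show "query S m c y = val y (core \<inter> set_decode c)"
        using query_val[of y c] that \<open>b < m\<close> by simp
      \<comment> \<open>So adding \<open>2 ^ b'\<close> to the code causes no carry and inserts
        \<open>b'\<close>.\<close>
      have "b' \<notin> set_decode c" using that b' by auto
      then have "set_decode (c + 2 ^ b') = insert b' (set_decode c)"
        using set_encode_insert[of "set_decode c" b'] set_encode_inverse[of "insert b' (set_decode c)"]
        by (simp add: add.commute)
      then have "core \<inter> set_decode (c + 2 ^ b') \<inter> {..m} = insert b' (core \<inter> set_decode c)"
        using that b' by auto
      then show "query S m (c + 2 ^ b') y = val y (insert b' (core \<inter> set_decode c))"
        using query_val[of y "c + 2 ^ b'"] that \<open>b < m\<close> by simp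
    qed
    show ?thesis
    proof (rule iffI; intro allI impI)
      fix y F
      assume *: "\<forall>y<Suc b. \<forall>c<2 ^ Suc b. query S m (c + 2 ^ b') y \<longleftrightarrow> query S m c y"
        and y: "y \<le> b" and F: "F \<subseteq> core \<inter> {..b}"
      have "finite F" using F finite_subset by blast
      then have dec: "set_decode (set_encode F) = F" by (rule set_encode_inverse)
      then have c: "set_decode (set_encode F) \<subseteq> {..b}" using F by auto
      then have "query S m (set_encode F + 2 ^ b') y = query S m (set_encode F) y"
        using * y unfolding set_decode_subset_iff by simp
      moreover have "core \<inter> F = F" using F by auto
      ultimately show "val y (insert b' F) = val y F" using eq[OF y c] by (simp add: dec)
    next
      fix y c :: nat
      assume *: "\<forall>y\<le>b. \<forall>F\<subseteq>core \<inter> {..b}. val y (insert b' F) = val y F"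
        and y: "y < Suc b" and c: "c < 2 ^ Suc b"
      have dec: "set_decode c \<subseteq> {..b}" using c by (simp only: set_decode_subset_iff)
      then have "core \<inter> set_decode c \<subseteq> core \<inter> {..b}" by blast
      then have "val y (insert b' (core \<inter> set_decode c)) = val y (core \<inter> set_decode c)"
        using * y by (simp add: less_Suc_eq_le)
      then show "query S m (c + 2 ^ b') y = query S m c y"
        using eq[OF _ dec, of y] y by simp
    qed
  qed
  \<comment> \<open>The extra disjunct does no harm, since \<open>m\<close> is itself good over
    \<open>b\<close>.\<close>
  have iff: "(b < b' \<and> Q b' (S \<inter> {m<..}) \<and>
       (\<forall>y<Suc b. \<forall>c<2 ^ Suc b. query S m (c + 2 ^ b') y \<longleftrightarrow> query S m c y) \<or> b' = m) \<longleftrightarrow>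
      good b b'" if "b' \<le> m" for b'
  proof (cases "b < b' \<and> b' \<in> core")
    case True
    then have bb': "b < b'" "b' \<in> core" by auto
    have "good b b' \<longleftrightarrow>
        (\<forall>y<Suc b. \<forall>c<2 ^ Suc b. query S m (c + 2 ^ b') y \<longleftrightarrow> query S m c y)"
      unfolding test[OF bb'(1) that bb'(2)] by (simp only: good_def bb' simp_thms)
    moreover have "Q b' (S \<inter> {m<..})" using Q_core[OF that] bb' by (simp only: T_def)
    ultimately show ?thesis using bb' good_m by (metis (no_types, lifting))
  next
    case False
    then show ?thesis
      using Q_core[OF that] good_m unfolding T_def[symmetric] good_def by blast
  qed
  have "step S b = (LEAST b'. good b b')"
    unfolding step_def Let_def m_def[symmetric]
  proof (rule Least_equality)
    have good: "good b (LEAST b'. good b b')" using good_m by (rule LeastI)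
    have le: "(LEAST b'. good b b') \<le> m" using good_m by (rule Least_le)
    from iff[OF le] good
    show "b < (LEAST b'. good b b') \<and> Q (LEAST b'. good b b') (S \<inter> {m<..}) \<and>
       (\<forall>y<Suc b. \<forall>c<2 ^ Suc b.
         query S m (c + 2 ^ (LEAST b'. good b b')) y \<longleftrightarrow> query S m c y) \<or>
       (LEAST b'. good b b') = m" by blast
    fix b' assume b': "b < b' \<and> Q b' (S \<inter> {m<..}) \<and>
       (\<forall>y<Suc b. \<forall>c<2 ^ Suc b. query S m (c + 2 ^ b') y \<longleftrightarrow> query S m c y) \<or> b' = m"
    show "(LEAST b'. good b b') \<le> b'"
    proof (cases "b' \<le> m")
      case True
      then have "good b b'" using iff b' by blast
      then show ?thesis by (rule Least_le)
    qed (use le in simp)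
  qed
  then show ?thesis by (simp add: b_def)
qed

lemma computable_next_elem:
  assumes "computable_on oracles n b"
  shows "computable_on oracles n (\<lambda>S xs. next_elem S (b S xs))"
  unfolding next_elem_def
  by (rule computable_Least)
    ((rule computable_intros decidable_oracle assms[THEN computable_tl])+,
      use next_elem in blast)

lemma decidable_Q_tail:
  assumes "computable_on oracles n m" "computable_on oracles n y"
  shows "decidable_on oracles n (\<lambda>S xs. Q (y S xs) (S \<inter> {m S xs<..}))"
proof (rule decidable_Q)
  show "decidable_on oracles (Suc n) (\<lambda>S ys. hd ys \<in> S \<inter> {m S (tl ys)<..})"
    unfolding Int_iff greaterThan_iff
    by (rule computable_intros decidable_oracle assms[THEN computable_tl])+
qed (use assms oracles_tail in auto)

lemma decidable_query:
  assumes "computable_on oracles n m" "computable_on oracles n c" "computable_on oracles n y"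
  shows "decidable_on oracles n (\<lambda>S xs. query S (m S xs) (c S xs) (y S xs))"
  unfolding query_def
proof (rule decidable_Q)
  show "decidable_on oracles (Suc n)
      (\<lambda>S ys. hd ys \<in> coded_part S (m S (tl ys)) (c S (tl ys)) \<union> S \<inter> {m S (tl ys)<..})"
    unfolding Un_iff Int_iff greaterThan_iff coded_part_def mem_Collect_eq
    by (rule computable_intros decidable_oracle decidable_set_decode decidable_Q_tail
        assms[THEN computable_tl])+
next
  fix S and xs :: "nat list" assume "S \<in> oracles"
  then show "coded_part S (m S xs) (c S xs) \<union> S \<inter> {m S xs<..} \<subseteq> A \<and>
      infinite (coded_part S (m S xs) (c S xs) \<union> S \<inter> {m S xs<..})"
    using coded_part_subset oracles_tail by simp
qed (rule assms)

lemma computable_step: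
  assumes "computable_on oracles n b"
  shows "computable_on oracles n (\<lambda>S xs. step S (b S xs))"
  unfolding step_def Let_def
  \<comment> \<open>The parameter \<open>b\<close> is lifted under up to three binders: the search
    variable \<open>b'\<close>, then \<open>y\<close>, then \<open>c\<close>.\<close>
  by (rule computable_Least)
    ((rule computable_intros computable_next_elem decidable_query decidable_Q_tail
       assms[THEN computable_tl] assms[THEN computable_tl, THEN computable_tl]
       assms[THEN computable_tl, THEN computable_tl, THEN computable_tl])+, blast)

lemma uniformly_computable_subset:
  "\<exists>B \<Phi>. B \<subseteq> A \<and> infinite B \<and>
     (\<forall>S. S \<subseteq> B \<and> infinite S \<longrightarrow> functional_computes \<Phi> S B)"
proof -
  \<comment> \<open>Only the number \<open>bs 0\<close> is built into the program; the oracle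
    supplies every further element.\<close>
  have bs: "rec_nat (bs 0) (\<lambda>_ r. step S r) i = bs i" if "S \<in> oracles" for S i
    by (induction i) (simp_all add: step_bs[OF that] del: bs.simps)
  \<comment> \<open>A strictly increasing sequence has \<open>i\<close> at most \<open>bs i\<close>,
    which bounds the search for an index.\<close>
  have mem: "x \<in> range bs \<longleftrightarrow> (\<exists>i<Suc x. bs i = x)" for x
    using strict_mono_imp_increasing[OF strict_mono_bs] by (auto simp: less_Suc_eq_le)
  have "decidable_on oracles 1
      (\<lambda>S xs. \<exists>i<Suc (hd xs). rec_nat (bs 0) (\<lambda>_ r. step S r) i = hd xs)"
    unfolding One_nat_def by (rule computable_intros computable_rec_nat computable_step)+
  then have "decidable_on oracles 1 (\<lambda>S xs. hd xs \<in> range bs)"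
    by (rule computable_on_cong) (simp only: bs mem)
  then obtain \<Phi> where \<Phi>: "\<forall>S\<in>oracles. \<forall>xs. length xs = 1 \<longrightarrow>
      reval S \<Phi> xs (of_bool (hd xs \<in> range bs))"
    unfolding computable_on_def ..
  have "functional_computes \<Phi> S (range bs)" if "S \<subseteq> range bs" "infinite S" for S
    unfolding functional_computes_def
  proof
    fix x
    have "reval S \<Phi> [x] (of_bool (hd [x] \<in> range bs))"
      using \<Phi> that unfolding oracles_def by (metis (mono_tags) One_nat_def length_Cons list.size(3) mem_Collect_eq)
    then show "reval S \<Phi> [x] (if x \<in> range bs then 1 else 0)"
      by (simp add: of_bool_def cong: if_cong)
  qed
  then show ?thesis using infinite_bs bs_core core_subset by blast
qed

end

section \<open>Stagewise enumeration by a relative c.e. operator, and the theorem\<close>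

definition code_initial :: "nat set \<Rightarrow> nat \<Rightarrow> nat" where
  "code_initial X j = 2 ^ j + (\<Sum>i<j. of_bool (i \<in> X) * 2 ^ i)"

text \<open>The code lists bits from the lowest position up, with an end marker on top. A new last
  bit takes the place of the marker, which moves up by one.\<close>

lemma code_bits_snoc: "code_bits (s @ [b]) = code_bits s + 2 ^ length s * (1 + of_bool b)"
  by (induction s) auto

lemma code_initial_eq: "code_initial X j = code_bits (map (\<lambda>i. i \<in> X) [0..<j])"
  by (induction j) (auto simp: code_initial_def code_bits_snoc)

text \<open>The same \<open>k\<close> bounds segment length and searches, so stage \<open>k\<close>
  depends on \<open>X\<close> below \<open>k\<close> only and stages are cumulative.\<close>

definition enumerated :: "prog \<Rightarrow> nat set \<Rightarrow> nat \<Rightarrow> nat \<Rightarrow> bool" where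
  "enumerated p X k x \<longleftrightarrow> (\<exists>j<Suc k. 0 < bounded_eval k p [code_initial X j, x])"

lemma enumerated_cong:
  assumes "X \<inter> {..<k} = Y \<inter> {..<k}"
  shows "enumerated p X k x = enumerated p Y k x"
proof -
  have "code_initial X j = code_initial Y j" if "j < Suc k" for j
  proof -
    have "i \<in> X \<longleftrightarrow> i \<in> Y" if "i < j" for i
    proof -
      have "i \<in> X \<inter> {..<k} \<longleftrightarrow> i \<in> Y \<inter> {..<k}" using assms by simp
      then show ?thesis using that \<open>j < Suc k\<close> by simp
    qed
    then show ?thesis by (simp add: code_initial_def)
  qed
  then show ?thesis by (auto simp: enumerated_def)
qed

lemma enumerated_mono: "enumerated p X k x \<Longrightarrow> k \<le> k' \<Longrightarrow> enumerated p X k' x"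
  unfolding enumerated_def using bounded_eval_mono
  by (metis gr0_conv_Suc less_le_trans Suc_le_mono)

lemma enumerated_iff:
  assumes "\<Theta> = {(\<sigma>, x). \<exists>r. reval {} p [code_bits \<sigma>, x] r}"
  shows "(\<exists>k. enumerated p X k x) \<longleftrightarrow> x \<in> apply_op \<Theta> X"
proof
  assume "\<exists>k. enumerated p X k x"
  then obtain j k r where "bounded_eval k p [code_initial X j, x] = Suc r"
    by (auto simp: enumerated_def gr0_conv_Suc)
  then have "reval {} p [code_bits (map (\<lambda>i. i \<in> X) [0..<j]), x] r"
    using bounded_eval_sound code_initial_eq by simp
  then have "(map (\<lambda>i. i \<in> X) [0..<j], x) \<in> \<Theta>" using assms by blast
  then show "x \<in> apply_op \<Theta> X" unfolding apply_op_def prefix_of_def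
    by (auto intro!: exI[of _ "map (\<lambda>i. i \<in> X) [0..<j]"])
next
  assume "x \<in> apply_op \<Theta> X"
  then obtain \<sigma> r where \<sigma>: "prefix_of \<sigma> X" "reval {} p [code_bits \<sigma>, x] r"
    using assms unfolding apply_op_def by blast
  have "\<sigma> = map (\<lambda>i. i \<in> X) [0..<length \<sigma>]"
    using \<sigma>(1) by (intro nth_equalityI) (auto simp: prefix_of_def)
  then have "code_bits \<sigma> = code_initial X (length \<sigma>)" by (simp add: code_initial_eq)
  then obtain t where "bounded_eval t p [code_initial X (length \<sigma>), x] = Suc r"
    using \<sigma>(2) bounded_eval_complete by metis
  then have "bounded_eval (max t (length \<sigma>)) p [code_initial X (length \<sigma>), x] = Suc r"
    by (rule bounded_eval_mono) simp
  then have "enumerated p X (max t (length \<sigma>)) x"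
    unfolding enumerated_def by (intro exI[of _ "length \<sigma>"]) auto
  then show "\<exists>k. enumerated p X k x" ..
qed

lemma decidable_enumerated:
  assumes X: "decidable_on \<C> (Suc n) (\<lambda>S ys. hd ys \<in> X S (tl ys))"
    and k: "computable_on \<C> n k" and x: "computable_on \<C> n x"
  shows "decidable_on \<C> n (\<lambda>S xs. enumerated p (X S xs) (k S xs) (x S xs))"
proof -
  \<comment> \<open>In \<open>code_initial\<close> the bit index stands in front of the segment
    length, on which the set does not depend.\<close>
  have X': "decidable_on \<C> (Suc (Suc n)) (\<lambda>S ys. hd ys \<in> X S (tl (tl ys)))"
    by (rule computable_subst[OF X, where u = "\<lambda>S ys. hd ys # tl (tl ys)", unfolded list.sel])
      (rule computable_env)+
  show ?thesis
    unfolding enumerated_def code_initial_def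
    by (rule computable_bounded_eval computable_sum X' k[THEN computable_tl] x[THEN computable_tl]
        k computable_intros)+
qed

theorem theorem1p4:
  fixes A :: "nat set" and \<Theta> :: "(bool list \<times> nat) set"
  assumes "infinite A"
    and "rel_ce_operator \<Theta>"
    and "\<forall>S. S \<subseteq> A \<and> infinite S \<longrightarrow> apply_op \<Theta> S = A"
  shows "\<exists>B \<Phi>. B \<subseteq> A \<and> infinite B \<and>
           (\<forall>S. S \<subseteq> B \<and> infinite S \<longrightarrow> functional_computes \<Phi> S B)"
proof -
  obtain p where p: "\<Theta> = {(\<sigma>, x). \<exists>r. reval {} p [code_bits \<sigma>, x] r}"
    using assms(2) unfolding rel_ce_operator_def ..
  interpret introenumerable A "enumerated p"
  proof
    show "(\<exists>k. enumerated p S k x) \<longleftrightarrow> x \<in> A" if "S \<subseteq> A" "infinite S" for S x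
      using enumerated_iff[OF p] assms(3) that by simp
  qed (fact assms(1), fact enumerated_cong, fact enumerated_mono)
  obtain tgt H where tgt: "tgt = id \<or> (\<exists>a. tgt = (\<lambda>_. a))" "\<And>m. m \<in> A \<Longrightarrow> tgt m \<in> A"
    and H: "homogeneous_queries A H (before_target tgt)"
    by (rule exists_homogeneous_queries) (rule that)
  have dec: "decidable_on \<C> n (\<lambda>S xs. before_target tgt (y S xs) (X S xs))"
    if X: "decidable_on \<C> (Suc n) (\<lambda>S ys. hd ys \<in> X S (tl ys))"
      and X_A: "\<And>S xs. S \<in> \<C> \<Longrightarrow> length xs = n \<Longrightarrow> X S xs \<subseteq> A \<and> infinite (X S xs)"
      and y: "computable_on \<C> n y" for \<C> n X y
  proof -
    let ?m = "\<lambda>S xs. LEAST i. i \<in> X S xs"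
    have m: "computable_on \<C> n ?m"
    proof (rule computable_Least[OF X])
      fix S and xs :: "nat list" assume "S \<in> \<C>" "length xs = n"
      then have "infinite (X S xs)" using X_A by simp
      then show "\<exists>i. i \<in> X S xs" using Inf_in by blast
    qed
    \<comment> \<open>The target is the identity or a constant, and a constant may be built into the
      program.\<close>
    have tgt_m: "computable_on \<C> n (\<lambda>S xs. tgt (?m S xs))"
      using tgt(1) m by (auto intro: computable_const)
    have X': "decidable_on \<C> (Suc n) (\<lambda>S ys. hd ys \<in> X S (tl ys) - {?m S (tl ys)})"
      unfolding Diff_iff singleton_iff
      by (rule X m[THEN computable_tl] computable_intros)+
    have X'': "decidable_on \<C> (Suc (Suc n))
        (\<lambda>S ys. hd ys \<in> X S (tl (tl ys)) - {?m S (tl (tl ys))})"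
      by (rule computable_subst[OF X', where u = "\<lambda>S ys. hd ys # tl (tl ys)", unfolded list.sel])
        (rule computable_env)+
    \<comment> \<open>The first stage enumerating the target exists: the oracle without its minimum
      is still an infinite subset of \<open>A\<close>, and the target lies in
      \<open>A\<close>.\<close>
    have "computable_on \<C> n
        (\<lambda>S xs. LEAST k. enumerated p (X S xs - {?m S xs}) k (tgt (?m S xs)))"
    proof (rule computable_Least)
      show "decidable_on \<C> (Suc n)
          (\<lambda>S ys. enumerated p (X S (tl ys) - {?m S (tl ys)}) (hd ys) (tgt (?m S (tl ys))))"
        by (rule decidable_enumerated X'' tgt_m[THEN computable_tl] computable_env)+
      fix S and xs :: "nat list" assume "S \<in> \<C>" "length xs = n"
      then have XS: "X S xs \<subseteq> A" "infinite (X S xs)" using X_A by auto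
      then have "?m S xs \<in> A"
        using Inf_in by (auto simp: Inf_nat_def)
      moreover have "X S xs - {?m S xs} \<subseteq> A" "infinite (X S xs - {?m S xs})"
        using XS by auto
      ultimately show "\<exists>k. enumerated p (X S xs - {?m S xs}) k (tgt (?m S xs))"
        using en_iff tgt(2) by blast
    qed
    then show ?thesis
      unfolding before_target_def no_later_def Inf_nat_def
      by (intro decidable_enumerated X' y)
  qed
  interpret computable_queries A H "before_target tgt"
    by (rule computable_queries.intro[OF H], rule computable_queries_axioms.intro, rule dec)
  show ?thesis by (rule uniformly_computable_subset)
qed

end
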